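(* Let $s,t,t' \in [0,1]$ with $t + t' > 1$, let $c,c' > 0$, and let $\alpha < \frac{(t + t' - 1)(1 - s)}{2}$. Then there is a constant $\kappa > 0$, depending only on $\alpha,s,t,t',c,c'$, such that the following holds for every $\delta \in (0,1]$. Let $A,B,C \subset [1,2]$ be non-empty $\delta$-separated sets such that $|A| = \delta^{-s}$, $B$ is a $(\delta,t,c)$-set, and $C$ is a $(\delta,t',c')$-set. Then $$ \max\{|A + B|_{\delta},|A \cdot C|_{\delta}\} \geq \kappa \, \delta^{-\alpha}|A|. $$
   Context: $|A|$ denotes the cardinality of a finite set $A$; $A + B = \{a + b : a \in A, b \in B\}$ and $A \cdot C = \{ac : a \in A, c \in C\}$. For a subset $A$ of a metric space, $|A|_{\delta}$ is the minimal number of $\delta$-balls needed to cover $A$. A bounded subset $P$ of a metric space $X$ is a $(\delta,s,C)$-set if $|P \cap B|_{\delta} \leq C \cdot |P|_{\delta} \cdot r^{s}$ for every $\delta \leq r \leq 1$ and every ball $B \subset X$ of radius $r$. Here the metric space is $\mathbb{R}$ with the usual metric. *)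

theory Defs
  imports "HOL-Analysis.Analysis" "HOL-Library.Set_Algebras"
begin

text \<open>
  The minimal number of closed balls of radius \<open>\<delta>\<close>, with centres anywhere in the
  ambient space, needed to cover \<open>A\<close>. The class \<^class>\<open>heine_borel\<close> guarantees that a bounded
  set has a finite cover whenever \<open>\<delta> > 0\<close>; where no finite cover exists the value is \<open>0\<close>.
\<close>

definition covering_number :: "real \<Rightarrow> 'a::heine_borel set \<Rightarrow> nat" where
  "covering_number \<delta> A = Inf {card F | F. finite F \<and> A \<subseteq> (\<Union>x\<in>F. cball x \<delta>)}"

definition delta_set :: "real \<Rightarrow> real \<Rightarrow> real \<Rightarrow> 'a::heine_borel set \<Rightarrow> bool" where
  "delta_set \<delta> s C P \<longleftrightarrow> bounded P \<and>
     (\<forall>r x. \<delta> \<le> r \<and> r \<le> 1 \<longrightarrow>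
        real (covering_number \<delta> (P \<inter> cball x r)) \<le> C * real (covering_number \<delta> P) * r powr s)"

definition delta_separated :: "real \<Rightarrow> 'a::metric_space set \<Rightarrow> bool" where
  "delta_separated \<delta> A \<longleftrightarrow> (\<forall>x\<in>A. \<forall>y\<in>A. x \<noteq> y \<longrightarrow> \<delta> \<le> dist x y)"

end

theory Submission
  imports Defs "HOL-Real_Asymp.Real_Asymp"
begin

text \<open>
  The theorem is an incidence bound in the plane. For \<open>b \<in> B\<close> and \<open>c \<in> C\<close> the line
  \<open>x = y / c + b\<close> contains the points \<open>(a + b, a c)\<close> with \<open>a \<in> A\<close>, so \<open>N = \<bar>B\<bar> \<bar>C\<bar>\<close> lines carry \<open>\<bar>A\<bar>\<close>
  separated points each, all of them close to a grid whose size \<open>M\<close> is the product of the covering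
  numbers of \<open>A + B\<close> and \<open>A * C\<close>. A lower bound for \<open>M\<close> comes from counting these incidences at
  two scales, as in the high-low method.

  Let \<open>f\<^sub>\<sigma> (x, y)\<close> be the sum over all lines of \<open>\<sigma> / (\<sigma>\<^sup>2 + (x - y / c - b)\<^sup>2)\<close>, let \<open>R = \<bar>A\<bar> \<delta>\<close>, and
  write \<open>f\<^sub>\<delta> = f\<^sub>R + (f\<^sub>\<delta> - f\<^sub>R)\<close>. The incidences say that the integral of \<open>f\<^sub>\<delta>\<close> over the
  neighbourhood of the grid, which has area of order \<open>\<delta>\<^sup>2 M\<close>, is of order at least \<open>N R\<close>.

  The low part \<open>f\<^sub>R\<close> is bounded pointwise by a multiple of \<open>N R powr (t - 1)\<close>, because \<open>B\<close> has at
  most about \<open>\<rho> powr t \<bar>B\<bar>\<close> points in an interval of length \<open>\<rho> \<ge> \<delta>\<close> (\<open>poisson_sum_bound\<close>).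

  The high part \<open>f\<^sub>\<delta> - f\<^sub>R\<close> is small in \<open>L\<^sup>2\<close>. Expanding the square gives one term for each pair of
  lines. If the pair is at distance \<open>e\<close>, measured by slopes and intercepts and cut off below at
  \<open>\<delta>\<close>, this term is at most of order \<open>1 / e\<close>, and for \<open>e > R\<close> cancellation improves it to
  \<open>R\<^sup>2 / e\<^sup>3\<close> (\<open>pair_energy_bound\<close>). A line has at most about \<open>\<rho> powr (t + t') N\<close> partners within
  distance \<open>\<rho>\<close>. Since \<open>1 < t + t' < 3\<close>, the sum over partners is dominated by the scale \<open>R\<close>, and
  the squared norm is at most of order \<open>N\<^sup>2 R powr (t + t' - 1)\<close> (\<open>kernel_sum_bound\<close>).

  The Poisson kernel is chosen because all integrals are then exact: integrating in \<open>x\<close>, and in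
  \<open>y\<close> against the weight \<open>1 / (1 + y\<^sup>2)\<close>, are both convolutions of Cauchy densities, and the term of
  a pair becomes the real part of a second difference of \<open>1 / z\<close>, where the cancellation is an
  algebraic identity.

  Together the two parts give \<open>M \<ge> const * \<delta> powr (-2) * R powr (3 - t - t')\<close>
  (\<open>separated_incidence_bound\<close>). For \<open>R = \<delta> powr (1 - s)\<close> the square root of the right side is a
  constant times \<open>\<delta> powr (- s - (t + t' - 1) (1 - s) / 2)\<close>, and the larger of the two covering
  numbers is at least the square root of \<open>M\<close>.
\<close>

section \<open>The Poisson kernel\<close>

text \<open>
  Up to the factor \<open>\<pi>\<close> this is the Poisson kernel of the half plane, also known as the density
  of the Cauchy distribution. It serves as a smooth stand-in for \<open>1 / a\<close> times the indicator
  of \<open>{-a..a}\<close>.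
\<close>

definition poisson :: "real \<Rightarrow> real \<Rightarrow> real" where
  "poisson a u = a / (a\<^sup>2 + u\<^sup>2)"

lemma has_bochner_integral_real_line:
  fixes f F :: "real \<Rightarrow> real"
  assumes "\<And>x. (F has_real_derivative f x) (at x)" "\<And>x. isCont f x" "\<And>x. f x \<ge> 0"
    and "(F \<longlongrightarrow> A) at_bot" "(F \<longlongrightarrow> B) at_top"
  shows "has_bochner_integral lborel f (B - A)"
proof -
  have A: "((F \<circ> real_of_ereal) \<longlongrightarrow> A) (at_right (-\<infinity>))"
    and B: "((F \<circ> real_of_ereal) \<longlongrightarrow> B) (at_left \<infinity>)"
    using assms(4,5) by (simp_all add: ereal_tendsto_simps)
  have "set_integrable lborel (einterval (-\<infinity>) \<infinity>) f"
    by (rule interval_integral_FTC_nonneg(1)[where F=F, OF _ _ _ _ A B]) (use assms in auto)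
  moreover have "(LBINT x=-\<infinity>..\<infinity>. f x) = B - A"
    by (rule interval_integral_FTC_nonneg(2)[where F=F, OF _ _ _ _ A B]) (use assms in auto)
  ultimately show ?thesis
    by (simp add: has_bochner_integral_iff set_integrable_def interval_lebesgue_integral_def
        set_lebesgue_integral_def)
qed

lemma has_bochner_integral_le:
  fixes f g :: "real \<Rightarrow> real"
  assumes "has_bochner_integral M f a" "has_bochner_integral M g b" "\<And>x. f x \<le> g x"
  shows "a \<le> b"
  using assms integral_mono[of M f g] by (auto simp: has_bochner_integral_iff)

lemma poisson_nonneg: "a \<ge> 0 \<Longrightarrow> poisson a u \<ge> 0"
  by (simp add: poisson_def)

lemma poisson_minus: "poisson a (- u) = poisson a u"
  by (simp add: poisson_def)

lemma poisson_scale: "k > 0 \<Longrightarrow> poisson (a / k) (u / k) = k * poisson a u"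
proof -
  assume k: "k > 0"
  have "(a / k)\<^sup>2 + (u / k)\<^sup>2 = (a\<^sup>2 + u\<^sup>2) / k\<^sup>2"
    by (simp add: power_divide add_divide_distrib)
  then show ?thesis
    unfolding poisson_def using k by (simp add: power2_eq_square)
qed

lemma isCont_poisson: "a > 0 \<Longrightarrow> isCont (\<lambda>x. poisson a (x - u)) x"
  unfolding poisson_def
  by (intro continuous_intros) (smt (verit) zero_le_power2 zero_less_power)

text \<open>
  The kernel is the derivative of a rescaled arctangent; the next two lemmas supply the
  antiderivative and its limits for the exact integrals below.
\<close>

lemma arctan_derivative:
  assumes "a > 0"
  shows "((\<lambda>x. arctan ((x - u) / a)) has_real_derivative poisson a (x - u)) (at x)"
proof -
  have "1 + ((x - u) / a)\<^sup>2 = (a\<^sup>2 + (x - u)\<^sup>2) / a\<^sup>2"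
    using assms by (simp add: power_divide add_divide_distrib)
  then show ?thesis
    using assms unfolding poisson_def
    by (auto intro!: derivative_eq_intros simp: power2_eq_square divide_simps)
qed

lemma arctan_limits:
  assumes "a > (0::real)"
  shows "((\<lambda>x. arctan ((x - u) / a)) \<longlongrightarrow> pi / 2) at_top"
    and "((\<lambda>x. arctan ((x - u) / a)) \<longlongrightarrow> - (pi / 2)) at_bot"
proof -
  have "filterlim (\<lambda>x. (x - u) / a) at_top at_top" "filterlim (\<lambda>x. (x - u) / a) at_bot at_bot"
    using assms by real_asymp+
  then show "((\<lambda>x. arctan ((x - u) / a)) \<longlongrightarrow> pi / 2) at_top"
    "((\<lambda>x. arctan ((x - u) / a)) \<longlongrightarrow> - (pi / 2)) at_bot"
    using filterlim_compose[OF tendsto_arctan_at_top] filterlim_compose[OF tendsto_arctan_at_bot]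
    by blast+
qed

text \<open>
  The convolution formula below comes from a partial fraction decomposition, which breaks down
  when the two kernels coincide. This is that degenerate case, with its own antiderivative.
\<close>

lemma poisson_square_integral:
  assumes "a > 0"
  shows "has_bochner_integral lborel (\<lambda>x. poisson a (x - u) * poisson a (x - u)) (pi / (2 * a))"
proof -
  define F where "F x = ((x - u) / (a\<^sup>2 + (x - u)\<^sup>2) + arctan ((x - u) / a) / a) / 2" for x
  have pos: "a\<^sup>2 + (x - u)\<^sup>2 > 0" for x
    using assms by (simp add: add_pos_nonneg)
  have 1: "(F has_real_derivative poisson a (x - u) * poisson a (x - u)) (at x)" for x
  proof -
    have "((\<lambda>x. (x - u) / (a\<^sup>2 + (x - u)\<^sup>2)) has_real_derivative
        ((a\<^sup>2 + (x - u)\<^sup>2) - (x - u) * (2 * (x - u))) / (a\<^sup>2 + (x - u)\<^sup>2)\<^sup>2) (at x)"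
      using pos[of x] by (auto intro!: derivative_eq_intros simp: power2_eq_square)
    from DERIV_cdivide[OF DERIV_add[OF this DERIV_cdivide[OF arctan_derivative[OF assms, of u x], of a]], of 2]
    have "(F has_real_derivative
       (((a\<^sup>2 + (x - u)\<^sup>2) - (x - u) * (2 * (x - u))) / (a\<^sup>2 + (x - u)\<^sup>2)\<^sup>2 + poisson a (x - u) / a) / 2) (at x)"
      unfolding F_def .
    moreover have "(((a\<^sup>2 + (x - u)\<^sup>2) - (x - u) * (2 * (x - u))) / (a\<^sup>2 + (x - u)\<^sup>2)\<^sup>2 + poisson a (x - u) / a) / 2
      = poisson a (x - u) * poisson a (x - u)"
    proof -
      define w where "w = a\<^sup>2 + (x - u)\<^sup>2"
      have w: "w > 0" "(x - u)*(x-u) = w - a\<^sup>2" using pos[of x] by (simp_all add: w_def power2_eq_square)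
      have "((w - (x - u) * (2 * (x - u))) / w\<^sup>2 + a / w / a) / 2 = (a / w) * (a / w)"
        using w(1) assms by (simp add: field_simps power2_eq_square) (use w(2) in algebra)
      then show ?thesis by (simp add: w_def poisson_def)
    qed
    ultimately show ?thesis by simp
  qed
  have rat: "((\<lambda>x. (x - u) / (a\<^sup>2 + (x - u)\<^sup>2)) \<longlongrightarrow> 0) at_top" "((\<lambda>x. (x - u) / (a\<^sup>2 + (x - u)\<^sup>2)) \<longlongrightarrow> 0) at_bot"
    by real_asymp+
  have 2: "(F \<longlongrightarrow> (0 + (pi/2) / a) / 2) at_top" "(F \<longlongrightarrow> (0 + (-(pi/2)) / a) / 2) at_bot"
    unfolding F_def using assms by (intro tendsto_intros rat arctan_limits; simp)+
  have "has_bochner_integral lborel (\<lambda>x. poisson a (x - u) * poisson a (x - u))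
     ((0 + (pi/2) / a) / 2 - (0 + (-(pi/2)) / a) / 2)"
    by (rule has_bochner_integral_real_line[OF 1 _ _ 2(2,1)])
      (use assms in \<open>auto intro!: continuous_intros isCont_poisson\<close>)
  then show ?thesis by (simp add: field_simps)
qed

text \<open>
  The semigroup property of the Cauchy distribution. With \<open>w = v - u\<close>, partial fractions express
  the product of the two kernels as a combination of derivatives of \<open>ln (P / Q)\<close> and of two
  arctangents, where \<open>P\<close> and \<open>Q\<close> are the two quadratic denominators. The logarithm tends to \<open>0\<close>
  at both ends, so only the arctangents contribute, each with total increment \<open>\<pi>\<close>.
\<close>

lemma poisson_convolution:
  assumes "a > 0" "b > 0"
  shows "has_bochner_integral lborel (\<lambda>x. poisson a (x - u) * poisson b (x - v))
           (pi * poisson (a + b) (u - v))"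
proof (cases "u = v \<and> a = b")
  case True
  then have "pi * poisson (a + b) (u - v) = pi / (2 * a)"
    using assms by (simp add: poisson_def power2_eq_square field_simps)
  then show ?thesis using poisson_square_integral[OF assms(1), of u] True by simp
next
  case False
  define w where "w = v - u"
  \<comment> \<open>\<open>D\<close> is the resultant of the two denominators.\<close>
  define D where "D = (w\<^sup>2 - a\<^sup>2 + b\<^sup>2)\<^sup>2 + 4 * a\<^sup>2 * w\<^sup>2"
  define P where "P x = a\<^sup>2 + (x - u)\<^sup>2" for x
  define Q where "Q x = b\<^sup>2 + (x - v)\<^sup>2" for x
  have D: "D = (w\<^sup>2 + (a - b)\<^sup>2) * (w\<^sup>2 + (a + b)\<^sup>2)"
    unfolding D_def by algebra
  have "w\<^sup>2 + (a - b)\<^sup>2 > 0"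
    using False by (auto simp: w_def sum_power2_gt_zero_iff)
  moreover have wab: "w\<^sup>2 + (a + b)\<^sup>2 > 0"
    using assms by (simp add: add_nonneg_pos)
  ultimately have Dpos: "D > 0" by (simp add: D)
  have pos: "P x > 0" "Q x > 0" for x
    using assms by (simp_all add: P_def Q_def add_pos_nonneg)
  define F where "F x = (a * b * w * (ln (P x / Q x))
      + b * (w\<^sup>2 - a\<^sup>2 + b\<^sup>2) * arctan ((x - u) / a)
      + a * (w\<^sup>2 - b\<^sup>2 + a\<^sup>2) * arctan ((x - v) / b)) / D" for x
  have 1: "(F has_real_derivative poisson a (x - u) * poisson b (x - v)) (at x)" for x
  proof -
    have ln': "((\<lambda>x. ln (P x / Q x)) has_real_derivative 2 * (x - u) / P x - 2 * (x - v) / Q x) (at x)"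
    proof -
      have "((\<lambda>x. ln (P x) - ln (Q x)) has_real_derivative 2 * (x - u) / P x - 2 * (x - v) / Q x) (at x)"
        using pos[of x] unfolding P_def Q_def
        by (auto intro!: derivative_eq_intros simp: divide_simps)
      moreover have "(\<lambda>x. ln (P x / Q x)) = (\<lambda>x. ln (P x) - ln (Q x))"
        by (rule ext) (use pos in \<open>simp add: ln_divide_pos\<close>)
      ultimately show ?thesis by simp
    qed
    have "(F has_real_derivative (a * b * w * (2 * (x - u) / P x - 2 * (x - v) / Q x)
      + b * (w\<^sup>2 - a\<^sup>2 + b\<^sup>2) * poisson a (x - u)
      + a * (w\<^sup>2 - b\<^sup>2 + a\<^sup>2) * poisson b (x - v)) / D) (at x)"
      unfolding F_def
      by (intro DERIV_cdivide DERIV_add DERIV_cmult ln' arctan_derivative assms)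
    moreover have "(a * b * w * (2 * (x - u) / P x - 2 * (x - v) / Q x)
      + b * (w\<^sup>2 - a\<^sup>2 + b\<^sup>2) * poisson a (x - u)
      + a * (w\<^sup>2 - b\<^sup>2 + a\<^sup>2) * poisson b (x - v)) / D = poisson a (x - u) * poisson b (x - v)"
    proof -
      have *: "2 * w * ((x - u) * Q x - (x - v) * P x) + (w\<^sup>2 - a\<^sup>2 + b\<^sup>2) * Q x
          + (w\<^sup>2 - b\<^sup>2 + a\<^sup>2) * P x = D"
        unfolding D_def P_def Q_def w_def by algebra
      have "a * b * w * (2 * (x - u) / P x - 2 * (x - v) / Q x)
      + b * (w\<^sup>2 - a\<^sup>2 + b\<^sup>2) * (a / P x) + a * (w\<^sup>2 - b\<^sup>2 + a\<^sup>2) * (b / Q x)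
      = a * b * (2 * w * ((x - u) * Q x - (x - v) * P x) + (w\<^sup>2 - a\<^sup>2 + b\<^sup>2) * Q x
          + (w\<^sup>2 - b\<^sup>2 + a\<^sup>2) * P x) / (P x * Q x)"
        using pos[of x] by (simp add: divide_simps) algebra
      then show ?thesis
        unfolding * poisson_def P_def[symmetric] Q_def[symmetric] using Dpos by simp
    qed
    ultimately show ?thesis by simp
  qed
  have ratio: "((\<lambda>x. P x / Q x) \<longlongrightarrow> 1) at_top" "((\<lambda>x. P x / Q x) \<longlongrightarrow> 1) at_bot"
    unfolding P_def Q_def by real_asymp+
  have lnl: "((\<lambda>x. ln (P x / Q x)) \<longlongrightarrow> 0) at_top" "((\<lambda>x. ln (P x / Q x)) \<longlongrightarrow> 0) at_bot"
    using tendsto_ln[OF ratio(1)] tendsto_ln[OF ratio(2)] by simp_all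
  let ?S = "\<lambda>m. (a * b * w * 0 + b * (w\<^sup>2 - a\<^sup>2 + b\<^sup>2) * m + a * (w\<^sup>2 - b\<^sup>2 + a\<^sup>2) * m) / D"
  have 2: "(F \<longlongrightarrow> ?S (pi / 2)) at_top" "(F \<longlongrightarrow> ?S (- (pi / 2))) at_bot"
    unfolding F_def using assms Dpos by (intro tendsto_intros lnl arctan_limits; simp)+
  have "has_bochner_integral lborel (\<lambda>x. poisson a (x - u) * poisson b (x - v))
     (?S (pi / 2) - ?S (- (pi / 2)))"
    by (rule has_bochner_integral_real_line[OF 1 _ _ 2(2,1)])
      (use assms in \<open>auto intro!: continuous_intros isCont_poisson mult_nonneg_nonneg poisson_nonneg\<close>)
  moreover have "?S (pi / 2) - ?S (- (pi / 2)) = pi * poisson (a + b) (u - v)"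
  proof -
    have "?S (pi / 2) - ?S (- (pi / 2)) = pi * ((b * (w\<^sup>2 - a\<^sup>2 + b\<^sup>2) + a * (w\<^sup>2 - b\<^sup>2 + a\<^sup>2)) / D)"
      using Dpos by (simp add: field_simps)
    also have "b * (w\<^sup>2 - a\<^sup>2 + b\<^sup>2) + a * (w\<^sup>2 - b\<^sup>2 + a\<^sup>2) = (w\<^sup>2 + (a - b)\<^sup>2) * (a + b)"
      by algebra
    also have "(w\<^sup>2 + (a - b)\<^sup>2) * (a + b) / D = (a + b) / (w\<^sup>2 + (a + b)\<^sup>2)"
      unfolding D using \<open>w\<^sup>2 + (a - b)\<^sup>2 > 0\<close> by (metis mult_divide_mult_cancel_left less_irrefl)
    also have "\<dots> = poisson (a + b) (u - v)"
      by (simp add: poisson_def w_def power2_commute add.commute)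
    finally show ?thesis .
  qed
  ultimately show ?thesis by simp
qed

text \<open>
  The weight \<open>poisson 1\<close> is itself a Cauchy density, so integrating along a line of slope \<open>m\<close>
  is again a convolution: after rescaling by \<open>\<bar>m\<bar>\<close> it widens the kernel from \<open>\<sigma>\<close> to \<open>\<sigma> + \<bar>m\<bar>\<close>.
\<close>

lemma poisson_line_integral:
  assumes "\<sigma> > 0"
  shows "has_bochner_integral lborel (\<lambda>y. poisson 1 y * poisson \<sigma> (m * y + d))
           (pi * poisson (\<sigma> + \<bar>m\<bar>) d)"
proof (cases "m = 0")
  case True
  have "has_bochner_integral lborel (\<lambda>y. poisson 1 (y - 0)) (pi / 2 - (- (pi / 2)))"
    by (rule has_bochner_integral_real_line[OF arctan_derivative _ _ arctan_limits(2,1)])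
      (auto intro!: isCont_poisson poisson_nonneg simp del: diff_zero diff_0_right)
  from has_bochner_integral_mult_left[OF this, of "poisson \<sigma> d"] True show ?thesis by simp
next
  case False
  have *: "poisson \<sigma> (m * y + d) = poisson (\<sigma> / \<bar>m\<bar>) (y - (- d / m)) / \<bar>m\<bar>" for y
  proof -
    have "poisson (\<sigma> / \<bar>m\<bar>) (y - (- d / m)) = poisson (\<sigma> / \<bar>m\<bar>) ((m * y + d) / \<bar>m\<bar>)"
    proof (cases "m > 0")
      case True then show ?thesis by (simp add: field_simps)
    next
      case False
      then have "y - (- d / m) = - ((m * y + d) / \<bar>m\<bar>)" using \<open>m \<noteq> 0\<close> by (simp add: field_simps)
      then show ?thesis by (simp only: poisson_minus)
    qed
    then show ?thesis using poisson_scale[of "\<bar>m\<bar>" \<sigma> "m * y + d"] False by simp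
  qed
  have "has_bochner_integral lborel (\<lambda>y. poisson 1 (y - 0) * poisson (\<sigma> / \<bar>m\<bar>) (y - (- d / m)))
     (pi * poisson (1 + \<sigma> / \<bar>m\<bar>) (0 - (- d / m)))"
    using assms False by (intro poisson_convolution) auto
  from has_bochner_integral_divide[OF this, of "\<bar>m\<bar>"]
  have "has_bochner_integral lborel (\<lambda>y. poisson 1 y * poisson \<sigma> (m * y + d))
     (pi * poisson (1 + \<sigma> / \<bar>m\<bar>) (d / m) / \<bar>m\<bar>)" by (simp add: *)
  moreover have "poisson (1 + \<sigma> / \<bar>m\<bar>) (d / m) = \<bar>m\<bar> * poisson (\<sigma> + \<bar>m\<bar>) d"
  proof -
    have "poisson (1 + \<sigma> / \<bar>m\<bar>) (d / m) = poisson ((\<sigma> + \<bar>m\<bar>) / \<bar>m\<bar>) (d / \<bar>m\<bar>)"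
    proof (cases "m > 0")
      case True then show ?thesis by (simp add: add_divide_distrib add.commute)
    next
      case False
      then have "d / \<bar>m\<bar> = - (d / m)" by simp
      moreover have "(\<sigma> + \<bar>m\<bar>) / \<bar>m\<bar> = 1 + \<sigma> / \<bar>m\<bar>" using \<open>m \<noteq> 0\<close> by (simp add: field_simps)
      ultimately show ?thesis by (simp only: poisson_minus)
    qed
    then show ?thesis using poisson_scale[of "\<bar>m\<bar>" "\<sigma> + \<bar>m\<bar>" d] False by simp
  qed
  ultimately show ?thesis using False by simp
qed

text \<open>
  Since \<open>poisson w d\<close> is the real part of \<open>1 / z\<close> with \<open>z = w + \<i> d\<close>, the left side is the real
  part of \<open>1 / z - 2 / (z + h) + 1 / (z + 2 h) = 2 h\<^sup>2 / (z (z + h) (z + 2 h))\<close>, and moving right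
  in the half plane \<open>Re z > 0\<close> only increases the modulus. The bound is of order \<open>1 / e\<close> for
  \<open>e \<le> h\<close> and of order \<open>h\<^sup>2 / e\<^sup>3\<close> for \<open>e \<ge> h\<close>. This cubic decay is the cancellation that makes
  the high-frequency part of the incidence count small.
\<close>

lemma poisson_second_difference:
  fixes w h d :: real
  assumes "w > 0" "h \<ge> 0" "0 < e" "e \<le> cmod (Complex w d)"
  shows "poisson w d - 2 * poisson (w + h) d + poisson (w + 2 * h) d \<le> 2 * h\<^sup>2 / (e * (max e h)\<^sup>2)"
proof -
  define z where "z = Complex w d"
  define H where "H = complex_of_real h"
  have Re: "poisson x d = Re (1 / Complex x d)" for x
    by (simp add: poisson_def Re_divide power2_eq_square)
  have shift: "Complex (w + h) d = z + H" "Complex (w + 2 * h) d = z + 2 * H"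
    by (auto simp: z_def H_def complex_eq_iff)
  have nz: "z \<noteq> 0" "z + H \<noteq> 0" "z + 2 * H \<noteq> 0"
    using assms unfolding shift[symmetric] by (auto simp: z_def complex_eq_iff)
  have "1 / z - 2 * (1 / (z + H)) + 1 / (z + 2 * H) = 2 * H\<^sup>2 / (z * ((z + H) * (z + 2 * H)))"
    using nz by (simp add: divide_simps) algebra
  then have "poisson w d - 2 * poisson (w + h) d + poisson (w + 2 * h) d
      = Re (2 * H\<^sup>2 / (z * ((z + H) * (z + 2 * H))))"
    unfolding Re shift z_def[symmetric]
    by (metis (no_types, lifting) Re_complex_of_real minus_complex.simps(1) of_real_numeral
        plus_complex.simps(1) complex_Re_numeral mult_2 )
  also have "\<dots> \<le> cmod (2 * H\<^sup>2 / (z * ((z + H) * (z + 2 * H))))"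
    by (rule complex_Re_le_cmod)
  also have "\<dots> = 2 * h\<^sup>2 / (cmod z * (cmod (z + H) * cmod (z + 2 * H)))"
    using assms(2) by (simp add: norm_divide norm_mult norm_power H_def)
  also have "\<dots> \<le> 2 * h\<^sup>2 / (e * (max e h)\<^sup>2)"
  proof -
    have mono: "cmod (Complex w d) \<le> cmod (Complex x d)" if "w \<le> x" for x
      using that assms(1) by (simp add: cmod_def power_mono)
    have re: "h \<le> cmod (Complex x d)" if "h \<le> x" for x
      using abs_Re_le_cmod[of "Complex x d"] that assms by simp
    have "e \<le> cmod z" using assms z_def by simp
    moreover have "max e h \<le> cmod (z + H)" "max e h \<le> cmod (z + 2 * H)"
      unfolding shift[symmetric] using assms mono[of "w + h"] mono[of "w + 2 * h"]
        re[of "w + h"] re[of "w + 2 * h"] by auto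
    ultimately have "e * (max e h)\<^sup>2 \<le> cmod z * (cmod (z + H) * cmod (z + 2 * H))"
      unfolding power2_eq_square using assms by (intro mult_mono) auto
    moreover have "e * (max e h)\<^sup>2 > 0" using assms by (auto simp: max_def)
    ultimately show ?thesis by (intro divide_left_mono) auto
  qed
  finally show ?thesis .
qed

section \<open>Sums over sets of power growth\<close>

lemma geometric_constant: "r < 1 \<Longrightarrow> A / (1 - r) * r + A = A / (1 - r)" for A r :: real
  by (simp add: field_simps)

text \<open>
  The bookkeeping of one dyadic step: \<open>z\<close> is the power of the scale in the claim, \<open>g\<close> the
  geometric ratio gained by passing to the neighbouring scale, \<open>h\<close> the factor from one shell.
\<close>

lemma shell_combination:
  fixes D :: real
  assumes "x * y = z" "a = z * g" "b * c = x * y * h"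
  shows "D * K * a + K * b * c = (D * g + h) * K * z"
proof -
  have "D * K * a + K * b * c = D * K * a + K * (b * c)" by (simp only: mult.assoc)
  then show ?thesis unfolding assms by (simp only: ring_distribs mult_ac)
qed

text \<open>
  Splitting into dyadic shells \<open>\<rho> / 2 < e i \<le> \<rho>\<close> gives a geometric series with ratio
  \<open>2 powr (q - T)\<close>, dominated by its largest scale because \<open>q < T\<close>. The induction halves the
  radius until it lies below every \<open>e i\<close>.
\<close>

lemma near_sum_bound:
  fixes e :: "'i \<Rightarrow> real"
  assumes "finite I" and pos: "\<And>i. i \<in> I \<Longrightarrow> e i > 0"
    and count: "\<And>\<rho>. \<rho> > 0 \<Longrightarrow> real (card {i\<in>I. e i \<le> \<rho>}) \<le> K * \<rho> powr T"
    and q: "0 < q" "q < T" and "K \<ge> 0" "\<rho> > 0"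
  shows "(\<Sum>i | i \<in> I \<and> e i \<le> \<rho>. e i powr (- q))
          \<le> 2 powr q / (1 - 2 powr (q - T)) * K * \<rho> powr (T - q)"
proof (cases "I = {}")
  case True
  have "2 powr (q - T) < (1::real)" using q by (simp add: powr_less_one)
  then show ?thesis using True \<open>K \<ge> 0\<close> by simp
next
  case False
  define m where "m = Min (e ` I)"
  have m: "m > 0" "\<And>i. i \<in> I \<Longrightarrow> m \<le> e i"
    using False assms(1) pos by (auto simp: m_def)
  define D where "D = 2 powr q / (1 - 2 powr (q - T))"
  have "2 powr (q - T) < (1::real)" using q by (simp add: powr_less_one)
  then have D: "D \<ge> 0" "D * 2 powr (q - T) + 2 powr q = D"
    unfolding D_def by (simp, intro geometric_constant)
  have "(\<Sum>i | i \<in> I \<and> e i \<le> \<rho>. e i powr (- q)) \<le> D * K * \<rho> powr (T - q)"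
    if "\<rho> > 0" "\<rho> < 2 ^ n * m" for n \<rho>
    using that
  proof (induction n arbitrary: \<rho>)
    case 0
    then have none: "{i. i \<in> I \<and> e i \<le> \<rho>} = {}" using m(2) by force
    show ?case unfolding none using D(1) \<open>K \<ge> 0\<close> by simp
  next
    case (Suc n)
    let ?near = "{i. i \<in> I \<and> e i \<le> \<rho> / 2}" and ?shell = "{i. i \<in> I \<and> \<rho> / 2 < e i \<and> e i \<le> \<rho>}"
    have "{i. i \<in> I \<and> e i \<le> \<rho>} = ?near \<union> ?shell" using Suc.prems by auto
    then have "(\<Sum>i | i \<in> I \<and> e i \<le> \<rho>. e i powr (- q))
        = (\<Sum>i\<in>?near. e i powr (- q)) + (\<Sum>i\<in>?shell. e i powr (- q))"
      using assms(1) by (simp only:) (rule sum.union_disjoint, auto)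
    also have "(\<Sum>i\<in>?near. e i powr (- q)) \<le> D * K * (\<rho> / 2) powr (T - q)"
      using Suc.IH[of "\<rho> / 2"] Suc.prems by simp
    also have "(\<Sum>i\<in>?shell. e i powr (- q)) \<le> real (card ?shell) * (\<rho> / 2) powr (- q)"
      by (rule sum_bounded_above) (use Suc.prems q in \<open>auto intro!: powr_mono2'\<close>)
    also have "real (card ?shell) \<le> real (card {i\<in>I. e i \<le> \<rho>})"
      using assms(1) by (intro of_nat_mono card_mono) auto
    also have "\<dots> \<le> K * \<rho> powr T" using count Suc.prems by simp
    also have "D * K * (\<rho> / 2) powr (T - q) + K * \<rho> powr T * (\<rho> / 2) powr (- q)
        = (D * 2 powr (q - T) + 2 powr q) * K * \<rho> powr (T - q)"
    proof -
      have half: "(\<rho> / 2) powr a = \<rho> powr a * 2 powr (- a)" for a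
        using Suc.prems by (simp add: powr_divide powr_minus_divide)
      have "\<rho> powr T * \<rho> powr (- q) = \<rho> powr (T - q)" by (simp flip: powr_add)
      moreover have "(\<rho> / 2) powr (T - q) = \<rho> powr (T - q) * 2 powr (q - T)"
        "(\<rho> / 2) powr (- q) = \<rho> powr (- q) * 2 powr q"
        using half[of "T - q"] half[of "- q"] unfolding minus_diff_eq minus_minus by blast+
      ultimately show ?thesis by (intro shell_combination) (simp_all only: mult_ac)
    qed
    finally show ?case using D(2) by (simp add: mult_right_mono)
  qed
  moreover obtain n where "\<rho> / m < 2 ^ n" using real_arch_pow[of 2 "\<rho> / m"] by auto
  ultimately show ?thesis using m(1) \<open>\<rho> > 0\<close> unfolding D_def[symmetric] by (simp add: field_simps)
qed

text \<open>
  The mirror image of the preceding lemma: for \<open>q > T\<close> the series is dominated by its smallest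
  scale, and the induction doubles the radius until it exceeds every \<open>e i\<close>.
\<close>

lemma far_sum_bound:
  fixes e :: "'i \<Rightarrow> real"
  assumes "finite I" and pos: "\<And>i. i \<in> I \<Longrightarrow> e i > 0"
    and count: "\<And>\<rho>. \<rho> > 0 \<Longrightarrow> real (card {i\<in>I. e i \<le> \<rho>}) \<le> K * \<rho> powr T"
    and q: "0 < q" "T < q" and "K \<ge> 0" "\<rho> > 0"
  shows "(\<Sum>i | i \<in> I \<and> \<rho> < e i. e i powr (- q))
          \<le> 2 powr T / (1 - 2 powr (T - q)) * K * \<rho> powr (T - q)"
proof (cases "I = {}")
  case True
  have "2 powr (T - q) < (1::real)" using q by (simp add: powr_less_one)
  then show ?thesis using True \<open>K \<ge> 0\<close> by simp
next
  case False
  define m where "m = Max (e ` I)"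
  have m: "\<And>i. i \<in> I \<Longrightarrow> e i \<le> m"
    using False assms(1) pos by (auto simp: m_def)
  define D where "D = 2 powr T / (1 - 2 powr (T - q))"
  have "2 powr (T - q) < (1::real)" using q by (simp add: powr_less_one)
  then have D: "D \<ge> 0" "D * 2 powr (T - q) + 2 powr T = D"
    unfolding D_def by (simp, intro geometric_constant)
  have "(\<Sum>i | i \<in> I \<and> \<rho> < e i. e i powr (- q)) \<le> D * K * \<rho> powr (T - q)"
    if "\<rho> > 0" "m < 2 ^ n * \<rho>" for n \<rho>
    using that
  proof (induction n arbitrary: \<rho>)
    case 0
    then have none: "{i. i \<in> I \<and> \<rho> < e i} = {}" using m by force
    show ?case unfolding none using D(1) \<open>K \<ge> 0\<close> by simp
  next
    case (Suc n)
    let ?far = "{i. i \<in> I \<and> 2 * \<rho> < e i}" and ?shell = "{i. i \<in> I \<and> \<rho> < e i \<and> e i \<le> 2 * \<rho>}"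
    have "{i. i \<in> I \<and> \<rho> < e i} = ?far \<union> ?shell" using Suc.prems by auto
    then have "(\<Sum>i | i \<in> I \<and> \<rho> < e i. e i powr (- q))
        = (\<Sum>i\<in>?far. e i powr (- q)) + (\<Sum>i\<in>?shell. e i powr (- q))"
      using assms(1) by (simp only:) (rule sum.union_disjoint, auto)
    also have "(\<Sum>i\<in>?far. e i powr (- q)) \<le> D * K * (2 * \<rho>) powr (T - q)"
      using Suc.IH[of "2 * \<rho>"] Suc.prems by simp
    also have "(\<Sum>i\<in>?shell. e i powr (- q)) \<le> real (card ?shell) * \<rho> powr (- q)"
      by (rule sum_bounded_above) (use Suc.prems q in \<open>auto intro!: powr_mono2'\<close>)
    also have "real (card ?shell) \<le> real (card {i\<in>I. e i \<le> 2 * \<rho>})"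
      using assms(1) by (intro of_nat_mono card_mono) auto
    also have "\<dots> \<le> K * (2 * \<rho>) powr T" using count Suc.prems by simp
    also have "D * K * (2 * \<rho>) powr (T - q) + K * (2 * \<rho>) powr T * \<rho> powr (- q)
        = (D * 2 powr (T - q) + 2 powr T) * K * \<rho> powr (T - q)"
    proof -
      have "\<rho> powr T * \<rho> powr (- q) = \<rho> powr (T - q)" by (simp flip: powr_add)
      moreover have "(2 * \<rho>) powr (T - q) = 2 powr (T - q) * \<rho> powr (T - q)"
        "(2 * \<rho>) powr T = 2 powr T * \<rho> powr T"
        using Suc.prems by (simp_all add: powr_mult)
      ultimately show ?thesis by (intro shell_combination) (simp_all only: mult_ac)
    qed
    finally show ?case using D(2) by (simp add: mult_right_mono)
  qed
  moreover obtain n where "m / \<rho> < 2 ^ n" using real_arch_pow[of 2 "m / \<rho>"] by auto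
  ultimately show ?thesis using \<open>\<rho> > 0\<close> unfolding D_def[symmetric] by (simp add: field_simps)
qed

text \<open>
  The pointwise bound on the count at scale \<open>R\<close>. Points within \<open>R\<close> of \<open>u\<close> contribute at most
  \<open>1 / R\<close> each; the quadratic tail of the kernel beats the growth exponent \<open>t < 2\<close> of the counting
  function, so the far points contribute the same order in total.
\<close>

lemma poisson_sum_bound:
  fixes P :: "real set"
  assumes "finite P" "0 < \<delta>" "\<delta> \<le> R" "K \<ge> 0" "t < 2"
    and count: "\<And>\<rho>. \<rho> > 0 \<Longrightarrow> real (card {p\<in>P. max \<delta> \<bar>u - p\<bar> \<le> \<rho>}) \<le> K * \<rho> powr t"
  shows "(\<Sum>p\<in>P. poisson R (u - p)) \<le> (1 + 2 powr t / (1 - 2 powr (t - 2))) * K * R powr (t - 1)"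
proof -
  have R: "R > 0" using assms by simp
  define e where "e p = max \<delta> \<bar>u - p\<bar>" for p
  let ?near = "{p. p \<in> P \<and> e p \<le> R}" and ?far = "{p. p \<in> P \<and> R < e p}"
  have "P = ?near \<union> ?far" by auto
  then have "(\<Sum>p\<in>P. poisson R (u - p)) = (\<Sum>p\<in>?near. poisson R (u - p)) + (\<Sum>p\<in>?far. poisson R (u - p))"
    using assms(1) by (metis (no_types, lifting) sum.union_disjoint finite_Un disjoint_iff
        mem_Collect_eq not_le)
  also have "(\<Sum>p\<in>?near. poisson R (u - p)) \<le> real (card ?near) * (1 / R)"
  proof (rule sum_bounded_above)
    fix p
    have "R * R \<le> R\<^sup>2 + (u - p)\<^sup>2" by (simp add: power2_eq_square)
    then have "R / (R\<^sup>2 + (u - p)\<^sup>2) \<le> R / (R * R)"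
      using R by (intro divide_left_mono) (auto intro!: mult_pos_pos add_pos_nonneg)
    then show "poisson R (u - p) \<le> 1 / R" using R by (simp add: poisson_def)
  qed
  also have "real (card ?near) * (1 / R) \<le> K * R powr t * (1 / R)"
    using count[of R] R by (intro mult_right_mono) (auto simp: e_def)
  also have "(\<Sum>p\<in>?far. poisson R (u - p)) \<le> (\<Sum>p\<in>?far. R * e p powr (- 2))"
  proof (rule sum_mono)
    fix p assume "p \<in> ?far"
    then have e: "e p = \<bar>u - p\<bar>" "e p > 0" using assms R by (auto simp: e_def)
    then have "R / (R\<^sup>2 + (u - p)\<^sup>2) \<le> R / (e p)\<^sup>2"
      using R by (intro divide_left_mono) (auto intro!: mult_pos_pos add_pos_nonneg)
    then show "poisson R (u - p) \<le> R * e p powr (- 2)"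
      using e(2) by (simp add: poisson_def powr_minus divide_inverse)
  qed
  also have "\<dots> = R * (\<Sum>p\<in>?far. e p powr (- 2))" by (simp add: sum_distrib_left)
  also have "(\<Sum>p\<in>?far. e p powr (- 2)) \<le> 2 powr t / (1 - 2 powr (t - 2)) * K * R powr (t - 2)"
    by (rule far_sum_bound) (use assms R in \<open>auto simp: e_def\<close>)
  also have "K * R powr t * (1 / R) + R * (2 powr t / (1 - 2 powr (t - 2)) * K * R powr (t - 2))
     = (1 + 2 powr t / (1 - 2 powr (t - 2))) * K * R powr (t - 1)"
  proof -
    have "R powr t * (1 / R) = R powr (t - 1)" using R by (simp add: powr_diff)
    moreover have "R * R powr (t - 2) = R powr (t - 1)"
      using R by (simp add: powr_diff field_simps power2_eq_square)
    moreover have "K * R powr t * (1 / R) + R * (c * K * R powr (t - 2))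
        = K * (R powr t * (1 / R)) + c * K * (R * R powr (t - 2))" for c
      by (simp only: mult_ac)
    ultimately show ?thesis by (simp only: ring_distribs mult_1_left)
  qed
  finally show ?thesis using R by (simp add: mult_left_mono)
qed

text \<open>
  The kernel of \<open>poisson_second_difference\<close> summed over one line's partners. It is at most
  of order \<open>1 / e\<close> up to scale \<open>R\<close> and of order \<open>R\<^sup>2 / e\<^sup>3\<close> beyond, so for a growth exponent strictly between
  \<open>1\<close> and \<open>3\<close> both halves are dominated by the scale \<open>R\<close>.
\<close>

lemma kernel_sum_bound:
  fixes e :: "'i \<Rightarrow> real"
  assumes "finite I" and pos: "\<And>i. i \<in> I \<Longrightarrow> e i > 0"
    and count: "\<And>\<rho>. \<rho> > 0 \<Longrightarrow> real (card {i\<in>I. e i \<le> \<rho>}) \<le> K * \<rho> powr T"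
    and T: "1 < T" "T < 3" and "K \<ge> 0" "0 \<le> h" "h \<le> R" "0 < R"
  shows "(\<Sum>i\<in>I. 2 * h\<^sup>2 / (e i * (max (e i) h)\<^sup>2))
     \<le> 2 * (2 / (1 - 2 powr (1 - T)) + 2 powr T / (1 - 2 powr (T - 3))) * K * R powr (T - 1)"
proof -
  let ?k = "\<lambda>i. 2 * h\<^sup>2 / (e i * (max (e i) h)\<^sup>2)"
  let ?near = "{i. i \<in> I \<and> e i \<le> R}" and ?far = "{i. i \<in> I \<and> R < e i}"
  have "I = ?near \<union> ?far" by auto
  then have "sum ?k I = sum ?k ?near + sum ?k ?far"
    using assms(1) by (metis (no_types, lifting) sum.union_disjoint finite_Un disjoint_iff
        mem_Collect_eq not_le)
  also have "sum ?k ?near \<le> (\<Sum>i\<in>?near. 2 * e i powr (- 1))"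
  proof (rule sum_mono)
    fix i assume "i \<in> ?near"
    then have e: "e i > 0" using pos by auto
    have "h\<^sup>2 \<le> (max (e i) h)\<^sup>2" using assms by (intro power_mono) auto
    moreover have "(max (e i) h)\<^sup>2 > 0" using e by (auto simp: max_def)
    ultimately have "h\<^sup>2 / (max (e i) h)\<^sup>2 \<le> 1" by (simp add: field_simps)
    then have "2 / e i * (h\<^sup>2 / (max (e i) h)\<^sup>2) \<le> 2 / e i * 1"
      using e by (intro mult_left_mono) auto
    then show "?k i \<le> 2 * e i powr (- 1)" using e by (simp add: powr_minus field_simps)
  qed
  also have "\<dots> = 2 * (\<Sum>i\<in>?near. e i powr (- 1))" by (simp add: sum_distrib_left)
  also have "(\<Sum>i\<in>?near. e i powr (- 1)) \<le> 2 powr 1 / (1 - 2 powr (1 - T)) * K * R powr (T - 1)"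
    by (rule near_sum_bound) (use assms in auto)
  also have "sum ?k ?far \<le> (\<Sum>i\<in>?far. 2 * R\<^sup>2 * e i powr (- 3))"
  proof (rule sum_mono)
    fix i assume "i \<in> ?far"
    then have e: "e i > 0" "max (e i) h = e i" using pos assms by auto
    have "2 * h\<^sup>2 / (e i * (e i)\<^sup>2) \<le> 2 * R\<^sup>2 / (e i * (e i)\<^sup>2)"
      using e(1) assms by (intro divide_right_mono mult_left_mono power_mono) auto
    also have "\<dots> = 2 * R\<^sup>2 * e i powr (- 3)"
      using e(1) by (simp add: powr_minus divide_inverse power2_eq_square power3_eq_cube)
    finally show "?k i \<le> 2 * R\<^sup>2 * e i powr (- 3)" using e(2) by simp
  qed
  also have "\<dots> = 2 * R\<^sup>2 * (\<Sum>i\<in>?far. e i powr (- 3))" by (simp add: sum_distrib_left)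
  also have "(\<Sum>i\<in>?far. e i powr (- 3)) \<le> 2 powr T / (1 - 2 powr (T - 3)) * K * R powr (T - 3)"
    by (rule far_sum_bound) (use assms in auto)
  also have "2 * (2 powr 1 / (1 - 2 powr (1 - T)) * K * R powr (T - 1))
      + 2 * R\<^sup>2 * (2 powr T / (1 - 2 powr (T - 3)) * K * R powr (T - 3))
     = 2 * (2 / (1 - 2 powr (1 - T)) + 2 powr T / (1 - 2 powr (T - 3))) * K * R powr (T - 1)"
  proof -
    have "R\<^sup>2 * R powr (T - 3) = R powr 2 * R powr (T - 3)" using \<open>0 < R\<close> by simp
    also have "\<dots> = R powr (T - 1)" by (simp flip: powr_add)
    finally have *: "R\<^sup>2 * R powr (T - 3) = R powr (T - 1)" .
    have "2 * R\<^sup>2 * (2 powr T / (1 - 2 powr (T - 3)) * K * R powr (T - 3))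
      = 2 * (2 powr T / (1 - 2 powr (T - 3))) * K * (R\<^sup>2 * R powr (T - 3))" by (simp only: mult_ac)
    then show ?thesis unfolding * by (simp add: algebra_simps)
  qed
  finally show ?thesis by (simp add: mult_left_mono)
qed

section \<open>Separated sets and covering numbers\<close>

text \<open>
  Cells of length \<open>\<delta>\<close> contain at most one point of a \<open>\<delta>\<close>-separated set; counting cells then
  bounds cardinalities.
\<close>

lemma delta_separated_floor_inj:
  fixes P :: "real set"
  assumes "delta_separated \<delta> P" "\<delta> > 0"
  shows "inj_on (\<lambda>p. \<lfloor>(p - x) / \<delta>\<rfloor>) P"
proof (rule inj_onI, rule ccontr)
  fix p q assume pq: "p \<in> P" "q \<in> P" "\<lfloor>(p - x) / \<delta>\<rfloor> = \<lfloor>(q - x) / \<delta>\<rfloor>" "p \<noteq> q"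
  then have "\<delta> \<le> \<bar>p - q\<bar>" using assms by (auto simp: delta_separated_def dist_real_def)
  moreover have "\<bar>(p - x) / \<delta> - (q - x) / \<delta>\<bar> < 1" using pq(3) by linarith
  moreover have "\<bar>(p - x) / \<delta> - (q - x) / \<delta>\<bar> = \<bar>p - q\<bar> / \<delta>"
    using assms(2) by (simp flip: diff_divide_distrib)
  ultimately show False using assms(2) by (simp add: field_simps)
qed

lemma delta_separated_finite:
  fixes P :: "real set"
  assumes "delta_separated \<delta> P" "\<delta> > 0" "bounded P"
  shows "finite P"
proof -
  obtain M where M: "\<And>p. p \<in> P \<Longrightarrow> \<bar>p\<bar> \<le> M" using assms(3) by (auto simp: bounded_iff)
  have "(\<lambda>p. \<lfloor>(p - 0) / \<delta>\<rfloor>) ` P \<subseteq> {\<lfloor>- M / \<delta>\<rfloor>..\<lfloor>M / \<delta>\<rfloor>}"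
  proof (rule image_subsetI)
    fix p assume "p \<in> P"
    then have "- M \<le> p - 0" "p - 0 \<le> M" using M[of p] by auto
    then have "- M / \<delta> \<le> (p - 0) / \<delta>" "(p - 0) / \<delta> \<le> M / \<delta>"
      using divide_right_mono[OF _ less_imp_le[OF assms(2)]] by blast+
    then show "\<lfloor>(p - 0) / \<delta>\<rfloor> \<in> {\<lfloor>- M / \<delta>\<rfloor>..\<lfloor>M / \<delta>\<rfloor>}"
      unfolding atLeastAtMost_iff by (intro conjI floor_mono)
  qed
  then have "finite ((\<lambda>p. \<lfloor>(p - 0) / \<delta>\<rfloor>) ` P)" by (rule finite_subset) simp
  then show ?thesis using delta_separated_floor_inj[OF assms(1,2), of 0] by (rule finite_imageD)
qed

text \<open>
  The existence of some finite cover excludes the default value \<open>Inf {} = 0\<close>.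
\<close>

lemma covering_number_attained:
  assumes "finite F0" "P \<subseteq> (\<Union>x\<in>F0. cball x \<delta>)"
  obtains F where "finite F" "P \<subseteq> (\<Union>x\<in>F. cball x \<delta>)" "card F = covering_number \<delta> P"
proof -
  let ?S = "{card F | F. finite F \<and> P \<subseteq> (\<Union>x\<in>F. cball x \<delta>)}"
  have "?S \<noteq> {}" using assms by blast
  then have "covering_number \<delta> P \<in> ?S" unfolding covering_number_def by (rule Inf_nat_def1)
  then show thesis using that by auto
qed

lemma covering_number_le_card:
  assumes "finite P" "\<delta> \<ge> 0"
  shows "covering_number \<delta> P \<le> card P"
  unfolding covering_number_def using assms by (intro wellorder_Inf_le1) force

lemma card_le_covering_number:
  fixes P :: "real set"
  assumes "delta_separated \<delta> P" "\<delta> > 0" "finite P"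
  shows "card P \<le> 3 * covering_number \<delta> P"
proof -
  have "P \<subseteq> (\<Union>x\<in>P. cball x \<delta>)" using assms by auto
  then obtain F where F: "finite F" "P \<subseteq> (\<Union>x\<in>F. cball x \<delta>)" "card F = covering_number \<delta> P"
    using covering_number_attained assms(3) by metis
  \<comment> \<open>The ball is closed, so it can hold three points, two of them at its ends.\<close>
  have three: "card (P \<inter> cball x \<delta>) \<le> 3" for x
  proof -
    have "(\<lambda>p. \<lfloor>(p - x) / \<delta>\<rfloor>) ` (P \<inter> cball x \<delta>) \<subseteq> {-1..1}"
    proof (rule image_subsetI)
      fix p assume "p \<in> P \<inter> cball x \<delta>"
      then have "-1 \<le> (p - x) / \<delta>" "(p - x) / \<delta> \<le> 1"
        using assms(2) by (auto simp: dist_real_def field_simps)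
      then show "\<lfloor>(p - x) / \<delta>\<rfloor> \<in> {-1..1}" unfolding atLeastAtMost_iff by linarith
    qed
    then have "card ((\<lambda>p. \<lfloor>(p - x) / \<delta>\<rfloor>) ` (P \<inter> cball x \<delta>)) \<le> card {-1..1::int}"
      by (intro card_mono) auto
    moreover have "inj_on (\<lambda>p. \<lfloor>(p - x) / \<delta>\<rfloor>) (P \<inter> cball x \<delta>)"
      by (rule inj_on_subset[OF delta_separated_floor_inj[OF assms(1,2)]]) auto
    ultimately show ?thesis by (simp add: card_image)
  qed
  have "P = (\<Union>x\<in>F. P \<inter> cball x \<delta>)" using F(2) by auto
  then have "card P \<le> (\<Sum>x\<in>F. card (P \<inter> cball x \<delta>))" using card_UN_le[OF F(1)] by metis
  also have "\<dots> \<le> of_nat (card F) * 3" by (rule sum_bounded_above) (rule three)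
  finally show ?thesis using F(3) by simp
qed

text \<open>
  For separated sets, cardinalities and covering numbers agree up to a factor of \<open>3\<close>. Replacing
  the distance by \<open>max \<delta> \<bar>u - p\<bar>\<close> makes the power bound valid at every radius: below \<open>\<delta>\<close> nothing
  is counted, and above \<open>1\<close> the extra \<open>+ 1\<close> in the constant covers the whole set.
\<close>

lemma delta_set_count:
  fixes P :: "real set"
  assumes "delta_set \<delta> s C P" "delta_separated \<delta> P" "0 < \<delta>" "0 \<le> s" "0 < C" "0 < \<rho>"
  shows "real (card {p\<in>P. max \<delta> \<bar>u - p\<bar> \<le> \<rho>}) \<le> (3 * C + 1) * real (card P) * \<rho> powr s"
proof -
  have fin: "finite P" using delta_separated_finite assms by (auto simp: delta_set_def)
  consider "\<rho> < \<delta>" | "\<delta> \<le> \<rho>" "\<rho> \<le> 1" | "\<rho> > 1" by linarith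
  then show ?thesis
  proof cases
    case 1
    then have "{p\<in>P. max \<delta> \<bar>u - p\<bar> \<le> \<rho>} = {}" by auto
    then show ?thesis using assms by (simp only: card.empty) simp
  next
    case 2
    let ?Q = "P \<inter> cball u \<rho>"
    have sub: "{p\<in>P. max \<delta> \<bar>u - p\<bar> \<le> \<rho>} \<subseteq> ?Q" by (auto simp: dist_real_def)
    have "delta_separated \<delta> ?Q" using assms(2) by (auto simp: delta_separated_def)
    then have "card ?Q \<le> 3 * covering_number \<delta> ?Q"
      using card_le_covering_number assms(3) fin by blast
    then have "real (card ?Q) \<le> 3 * real (covering_number \<delta> ?Q)" by linarith
    also have "\<dots> \<le> 3 * (C * real (covering_number \<delta> P) * \<rho> powr s)"
      using assms(1) 2 by (simp add: delta_set_def)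
    also have "\<dots> \<le> 3 * (C * real (card P) * \<rho> powr s)"
      using covering_number_le_card[OF fin, of \<delta>] assms
      by (intro mult_left_mono mult_right_mono) auto
    also have "\<dots> \<le> (3 * C + 1) * real (card P) * \<rho> powr s" by (simp add: algebra_simps)
    finally show ?thesis using card_mono[OF _ sub] fin by simp
  next
    case 3
    then have "1 \<le> \<rho> powr s" using assms by (simp add: ge_one_powr_ge_zero)
    then have "1 * 1 \<le> (3 * C + 1) * \<rho> powr s" using assms by (intro mult_mono) auto
    then have "real (card P) * 1 \<le> real (card P) * ((3 * C + 1) * \<rho> powr s)"
      by (intro mult_left_mono) auto
    moreover have "card {p\<in>P. max \<delta> \<bar>u - p\<bar> \<le> \<rho>} \<le> card P" using fin by (intro card_mono) auto
    ultimately show ?thesis by (simp add: algebra_simps)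
  qed
qed

section \<open>The energy of the difference between two scales\<close>

text \<open>
  A line \<open>i\<close> is \<open>x = \<gamma> i * y + \<beta> i\<close>; the function counts, with weight about \<open>1 / \<sigma>\<close>, the lines that
  pass within \<open>\<sigma>\<close> of \<open>(x, y)\<close>.
\<close>

definition smoothed_count :: "'i set \<Rightarrow> ('i \<Rightarrow> real) \<Rightarrow> ('i \<Rightarrow> real) \<Rightarrow> real \<Rightarrow> real \<Rightarrow> real \<Rightarrow> real" where
  "smoothed_count I \<gamma> \<beta> \<sigma> x y = (\<Sum>i\<in>I. poisson \<sigma> (x - (\<gamma> i * y + \<beta> i)))"

text \<open>
  Up to factors of \<open>\<pi>\<close>, the contribution of two lines to the squared \<open>L\<^sup>2\<close> norm of the difference of
  the counts at scales \<open>\<delta>\<close> and \<open>R\<close>: for \<open>m = 0\<close> on a horizontal line where they are \<open>d\<close> apart, and in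
  general over the plane with weight \<open>poisson 1 y\<close>, where \<open>m\<close> is the distance of their slopes
  and \<open>d\<close> the difference of their intercepts.
\<close>

definition pair_energy :: "real \<Rightarrow> real \<Rightarrow> real \<Rightarrow> real \<Rightarrow> real" where
  "pair_energy \<delta> R m d = poisson (2 * \<delta> + m) d - 2 * poisson (\<delta> + R + m) d + poisson (2 * R + m) d"

lemma horizontal_energy:
  assumes "0 < \<delta>" "0 < R"
  shows "has_bochner_integral lborel
    (\<lambda>x. (smoothed_count I \<gamma> \<beta> \<delta> x y - smoothed_count I \<gamma> \<beta> R x y)\<^sup>2)
    (pi * (\<Sum>i\<in>I. \<Sum>j\<in>I. pair_energy \<delta> R 0 ((\<gamma> i - \<gamma> j) * y + (\<beta> i - \<beta> j))))"
proof -
  define u where "u i = \<gamma> i * y + \<beta> i" for i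
  have pair: "has_bochner_integral lborel
      (\<lambda>x. (poisson \<delta> (x - u i) - poisson R (x - u i)) * (poisson \<delta> (x - u j) - poisson R (x - u j)))
      (pi * pair_energy \<delta> R 0 (u i - u j))" for i j
  proof -
    have "has_bochner_integral lborel
      (\<lambda>x. poisson \<delta> (x - u i) * poisson \<delta> (x - u j) - poisson \<delta> (x - u i) * poisson R (x - u j)
        - poisson R (x - u i) * poisson \<delta> (x - u j) + poisson R (x - u i) * poisson R (x - u j))
      (pi * poisson (\<delta> + \<delta>) (u i - u j) - pi * poisson (\<delta> + R) (u i - u j)
        - pi * poisson (R + \<delta>) (u i - u j) + pi * poisson (R + R) (u i - u j))"
      by (intro has_bochner_integral_add has_bochner_integral_diff poisson_convolution assms)
    then show ?thesis by (simp add: pair_energy_def algebra_simps)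
  qed
  have "has_bochner_integral lborel
    (\<lambda>x. \<Sum>i\<in>I. \<Sum>j\<in>I. (poisson \<delta> (x - u i) - poisson R (x - u i)) * (poisson \<delta> (x - u j) - poisson R (x - u j)))
    (\<Sum>i\<in>I. \<Sum>j\<in>I. pi * pair_energy \<delta> R 0 (u i - u j))"
    by (intro has_bochner_integral_sum pair)
  moreover have "(\<Sum>i\<in>I. \<Sum>j\<in>I. (poisson \<delta> (x - u i) - poisson R (x - u i)) * (poisson \<delta> (x - u j) - poisson R (x - u j)))
    = (smoothed_count I \<gamma> \<beta> \<delta> x y - smoothed_count I \<gamma> \<beta> R x y)\<^sup>2" for x
    unfolding smoothed_count_def u_def power2_eq_square by (simp flip: sum_subtractf sum_product)
  moreover have "u i - u j = (\<gamma> i - \<gamma> j) * y + (\<beta> i - \<beta> j)" for i j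
    by (simp add: u_def algebra_simps)
  ultimately show ?thesis by (simp add: sum_distrib_left)
qed

lemma total_energy:
  assumes "0 < \<delta>" "0 < R"
  shows "has_bochner_integral lborel
    (\<lambda>y. poisson 1 y * (\<Sum>i\<in>I. \<Sum>j\<in>I. pair_energy \<delta> R 0 ((\<gamma> i - \<gamma> j) * y + (\<beta> i - \<beta> j))))
    (pi * (\<Sum>i\<in>I. \<Sum>j\<in>I. pair_energy \<delta> R \<bar>\<gamma> i - \<gamma> j\<bar> (\<beta> i - \<beta> j)))"
proof -
  have pair: "has_bochner_integral lborel
      (\<lambda>y. poisson 1 y * pair_energy \<delta> R 0 (m * y + d)) (pi * pair_energy \<delta> R \<bar>m\<bar> d)" for m d
  proof -
    have "has_bochner_integral lborel
      (\<lambda>y. poisson 1 y * poisson (2 * \<delta>) (m * y + d) - 2 * (poisson 1 y * poisson (\<delta> + R) (m * y + d))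
         + poisson 1 y * poisson (2 * R) (m * y + d))
      (pi * poisson (2 * \<delta> + \<bar>m\<bar>) d - 2 * (pi * poisson (\<delta> + R + \<bar>m\<bar>) d) + pi * poisson (2 * R + \<bar>m\<bar>) d)"
      by (intro has_bochner_integral_add has_bochner_integral_diff has_bochner_integral_mult_right
          poisson_line_integral) (use assms in auto)
    then show ?thesis by (simp add: pair_energy_def algebra_simps)
  qed
  have "has_bochner_integral lborel
    (\<lambda>y. \<Sum>i\<in>I. \<Sum>j\<in>I. poisson 1 y * pair_energy \<delta> R 0 ((\<gamma> i - \<gamma> j) * y + (\<beta> i - \<beta> j)))
    (\<Sum>i\<in>I. \<Sum>j\<in>I. pi * pair_energy \<delta> R \<bar>\<gamma> i - \<gamma> j\<bar> (\<beta> i - \<beta> j))"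
    by (intro has_bochner_integral_sum pair)
  then show ?thesis by (simp add: sum_distrib_left)
qed

text \<open>
  With \<open>w = 2 \<delta> + \<bar>m\<bar>\<close> and \<open>h = R - \<delta>\<close> the energy of a pair is a second difference of the kernel
  in its width.
\<close>

lemma pair_energy_bound:
  assumes "0 < \<delta>" "\<delta> \<le> R"
  shows "pair_energy \<delta> R \<bar>m\<bar> d
    \<le> 2 * (R - \<delta>)\<^sup>2 / (max \<delta> (max \<bar>d\<bar> \<bar>m\<bar>) * (max (max \<delta> (max \<bar>d\<bar> \<bar>m\<bar>)) (R - \<delta>))\<^sup>2)"
proof -
  let ?z = "Complex (2 * \<delta> + \<bar>m\<bar>) d"
  have "\<bar>Re ?z\<bar> \<le> cmod ?z" "\<bar>Im ?z\<bar> \<le> cmod ?z" by (rule abs_Re_le_cmod, rule abs_Im_le_cmod)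
  then have z: "max \<delta> (max \<bar>d\<bar> \<bar>m\<bar>) \<le> cmod ?z" using assms by simp
  have eqs: "\<delta> + R + \<bar>m\<bar> = (2 * \<delta> + \<bar>m\<bar>) + (R - \<delta>)"
    "2 * R + \<bar>m\<bar> = (2 * \<delta> + \<bar>m\<bar>) + 2 * (R - \<delta>)" by auto
  show ?thesis
    unfolding pair_energy_def eqs by (rule poisson_second_difference) (use assms z in auto)
qed

section \<open>Incidences between lines and grids\<close>

text \<open>
  Every line \<open>i\<close> carries the \<open>\<delta>\<close>-separated points \<open>(px i a, py i a)\<close>, all of which lie in the
  \<open>\<delta>\<close>-neighbourhood of the grid \<open>X \<times> Y\<close>. Boxes of side \<open>\<delta>\<close> around these points give a lower bound
  for the integral of the count at scale \<open>\<delta>\<close> over the \<open>2 \<delta>\<close>-neighbourhood of the grid. That count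
  is at most \<open>L + F\<close>, where \<open>F\<close> is the difference between scales \<open>\<delta>\<close> and \<open>R\<close>, and
  \<open>F \<le> \<mu> / 2 + F\<^sup>2 / (2 \<mu>)\<close> replaces Cauchy-Schwarz, leaving \<open>\<mu>\<close> to be optimised. Both sides are
  compared pointwise and then integrated first in \<open>x\<close> and then in \<open>y\<close>, each time through sums of
  functions with known integrals.
\<close>

lemma incidence_inequality:
  fixes X Y :: "real set" and px py :: "'i \<Rightarrow> 'a \<Rightarrow> real"
  assumes fin: "finite X" "finite Y" "finite I" "finite A"
    and \<delta>: "0 < \<delta>" "\<delta> \<le> 1" "\<delta> \<le> R" and "\<mu> > 0" "L \<ge> 0"
    and slope: "\<And>i. i \<in> I \<Longrightarrow> \<bar>\<gamma> i\<bar> \<le> 1"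
    and on_line: "\<And>i a. i \<in> I \<Longrightarrow> a \<in> A \<Longrightarrow> px i a = \<gamma> i * py i a + \<beta> i"
    and separated: "\<And>i a a'. i \<in> I \<Longrightarrow> a \<in> A \<Longrightarrow> a' \<in> A \<Longrightarrow> a \<noteq> a' \<Longrightarrow> \<delta> \<le> \<bar>px i a - px i a'\<bar>"
    and cover: "\<And>i a. i \<in> I \<Longrightarrow> a \<in> A \<Longrightarrow> px i a \<in> (\<Union>x\<in>X. cball x \<delta>) \<and> py i a \<in> (\<Union>y\<in>Y. cball y \<delta>)"
    and range: "\<And>i a. i \<in> I \<Longrightarrow> a \<in> A \<Longrightarrow> py i a \<in> {1..4}"
    and low: "\<And>x y. smoothed_count I \<gamma> \<beta> R x y \<le> L"
    and high: "(\<Sum>i\<in>I. \<Sum>j\<in>I. pair_energy \<delta> R \<bar>\<gamma> i - \<gamma> j\<bar> (\<beta> i - \<beta> j)) \<le> S"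
  shows "real (card I) * real (card A) * \<delta> / 2
    \<le> 16 * \<delta>\<^sup>2 * real (card X) * real (card Y) * (L + \<mu> / 2) + 11 * pi\<^sup>2 * S / \<mu>"
proof -
  \<comment> \<open>The open interval of length \<open>\<delta>\<close>: those around \<open>\<delta>\<close>-separated points are disjoint.
    Counting with multiplicity, \<open>W Z\<close> dominates the indicator of a neighbourhood of \<open>Z\<close>.\<close>
  define J :: "real \<Rightarrow> real \<Rightarrow> real" where "J p = indicator {p - \<delta> / 2<..<p + \<delta> / 2}" for p
  define W :: "real set \<Rightarrow> real \<Rightarrow> real" where "W Z z = (\<Sum>p\<in>Z. indicator {p - 2 * \<delta>..p + 2 * \<delta>} z)" for Z z
  define F where "F x y = smoothed_count I \<gamma> \<beta> \<delta> x y - smoothed_count I \<gamma> \<beta> R x y" for x y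
  define E where "E y = (\<Sum>i\<in>I. \<Sum>j\<in>I. pair_energy \<delta> R 0 ((\<gamma> i - \<gamma> j) * y + (\<beta> i - \<beta> j)))" for y
  have J_eq: "J p z = (if \<bar>z - p\<bar> < \<delta> / 2 then 1 else 0)" for p z
  proof -
    have "z \<in> {p - \<delta> / 2<..<p + \<delta> / 2} \<longleftrightarrow> \<bar>z - p\<bar> < \<delta> / 2" 
      unfolding greaterThanLessThan_iff abs_less_iff by auto
    then show ?thesis by (simp add: J_def indicator_def)
  qed
  have J_int: "has_bochner_integral lborel (J p) \<delta>" for p
  proof -
    have "has_bochner_integral lborel (indicator {p - \<delta> / 2<..<p + \<delta> / 2}) (measure lborel {p - \<delta> / 2<..<p + \<delta> / 2})"
      by (rule has_bochner_integral_real_indicator) (use \<delta> in auto)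
    then show ?thesis using \<delta> by (simp add: J_def)
  qed
  have W_int: "has_bochner_integral lborel (W Z) (4 * \<delta> * real (card Z))" for Z
  proof -
    have "has_bochner_integral lborel (indicator {p - 2 * \<delta>..p + 2 * \<delta>}) (measure lborel {p - 2 * \<delta>..p + 2 * \<delta>})" for p
      by (rule has_bochner_integral_real_indicator) (use \<delta> in auto)
    then have "has_bochner_integral lborel (indicator {p - 2 * \<delta>..p + 2 * \<delta>}) (4 * \<delta>)" for p
      using \<delta> by simp
    then have "has_bochner_integral lborel (W Z) (\<Sum>p\<in>Z. 4 * \<delta>)"
      unfolding W_def by (intro has_bochner_integral_sum)
    then show ?thesis by (simp add: mult.commute)
  qed
  have W_nonneg: "W Z z \<ge> 0" for Z z unfolding W_def by (intro sum_nonneg) auto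
  have W_ge: "W Z z \<ge> 1" if Z: "finite Z" "p \<in> (\<Union>q\<in>Z. cball q \<delta>)" "\<bar>z - p\<bar> < \<delta> / 2" for Z z p
  proof -
    obtain q where q: "q \<in> Z" "\<bar>q - p\<bar> \<le> \<delta>" using Z(2) by (auto simp: dist_real_def)
    then have "indicator {q - 2 * \<delta>..q + 2 * \<delta>} z = (1::real)" using Z(3) \<delta> by (auto simp: indicator_def abs_if split: if_splits)
    then show ?thesis unfolding W_def using member_le_sum[OF q(1), of "\<lambda>p. indicat_real {p - 2 * \<delta>..p + 2 * \<delta>} z"] Z(1) by simp
  qed
  have pointwise: "(\<Sum>i\<in>I. \<Sum>a\<in>A. J (px i a) x * (J (py i a) y / (2 * \<delta>)))
      \<le> W X x * (W Y y * (L + \<mu> / 2)) + (F x y)\<^sup>2 * (11 / \<mu> * poisson 1 y)" (is "?lhs \<le> ?rhs") for x y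
  proof (cases "\<exists>i\<in>I. \<exists>a\<in>A. \<bar>x - px i a\<bar> < \<delta> / 2 \<and> \<bar>y - py i a\<bar> < \<delta> / 2")
    case False
    then have "?lhs = 0" by (intro sum.neutral ballI) (auto simp: J_eq)
    moreover have "?rhs \<ge> 0" using W_nonneg \<open>L \<ge> 0\<close> \<open>\<mu> > 0\<close> by (intro add_nonneg_nonneg mult_nonneg_nonneg) (auto simp: poisson_nonneg)
    ultimately show ?thesis by simp
  next
    case True
    then obtain i0 a0 where ia: "i0 \<in> I" "a0 \<in> A" "\<bar>x - px i0 a0\<bar> < \<delta> / 2" "\<bar>y - py i0 a0\<bar> < \<delta> / 2" by auto
    have W1: "W X x \<ge> 1" "W Y y \<ge> 1" using W_ge[OF fin(1) _ ia(3)] W_ge[OF fin(2) _ ia(4)] cover ia by auto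
    \<comment> \<open>The weight \<open>poisson 1 y\<close> is bounded below on the strip that contains the boxes.\<close>
    have "0 \<le> y" "y \<le> 9 / 2" using range[OF ia(1,2)] ia(4) \<delta> by (auto simp: abs_if split: if_splits)
    then have "y\<^sup>2 \<le> (9 / 2)\<^sup>2" by (intro power_mono)
    then have "1 + y\<^sup>2 \<le> 22" by (simp add: power2_eq_square)
    then have chi: "1 \<le> 22 * poisson 1 y" by (simp add: poisson_def field_simps add_pos_nonneg)
    have row: "(\<Sum>a\<in>A. J (px i a) x * (J (py i a) y / (2 * \<delta>))) \<le> poisson \<delta> (x - (\<gamma> i * y + \<beta> i))"
      if i: "i \<in> I" for i
    proof (cases "\<exists>a\<in>A. \<bar>x - px i a\<bar> < \<delta> / 2 \<and> \<bar>y - py i a\<bar> < \<delta> / 2")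
      case False
      then have "(\<Sum>a\<in>A. J (px i a) x * (J (py i a) y / (2 * \<delta>))) = 0"
        by (intro sum.neutral ballI) (auto simp: J_eq)
      then show ?thesis using \<delta> by (simp add: poisson_nonneg)
    next
      case True
      \<comment> \<open>At most one box of the line contains \<open>(x, y)\<close>, and the line passes within \<open>\<delta>\<close>.\<close>
      then obtain a where a: "a \<in> A" "\<bar>x - px i a\<bar> < \<delta> / 2" "\<bar>y - py i a\<bar> < \<delta> / 2" by auto
      have "J (px i b) x = 0" if "b \<in> A - {a}" for b
      proof -
        have "\<delta> \<le> \<bar>px i a - px i b\<bar>" using separated[OF i a(1), of b] that by auto
        then have "\<not> \<bar>x - px i b\<bar> < \<delta> / 2" using a(2) by linarith
        then show ?thesis by (simp add: J_eq)
      qed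
      then have "(\<Sum>b\<in>A. J (px i b) x * (J (py i b) y / (2 * \<delta>))) = J (px i a) x * (J (py i a) y / (2 * \<delta>))"
        using a(1) fin(4) by (subst sum.remove[of _ a]) (auto intro!: sum.neutral)
      also have "\<dots> \<le> 1 / (2 * \<delta>)" using \<delta> by (simp add: J_eq)
      also have "\<dots> \<le> poisson \<delta> (x - (\<gamma> i * y + \<beta> i))"
      proof -
        have "\<bar>\<gamma> i * (y - py i a)\<bar> \<le> 1 * \<bar>y - py i a\<bar>"
          unfolding abs_mult using slope[OF i] by (intro mult_right_mono) auto
        then have vertical: "\<bar>\<gamma> i * (y - py i a)\<bar> \<le> \<delta> / 2" using a(3) by simp
        have "x - (\<gamma> i * y + \<beta> i) = (x - px i a) - \<gamma> i * (y - py i a)"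
          using on_line[OF i a(1)] by (simp add: algebra_simps)
        then have "\<bar>x - (\<gamma> i * y + \<beta> i)\<bar> \<le> \<bar>x - px i a\<bar> + \<bar>\<gamma> i * (y - py i a)\<bar>"
          by (simp only: abs_triangle_ineq4)
        also have "\<dots> \<le> \<delta> / 2 + \<delta> / 2" by (rule add_mono[OF less_imp_le[OF a(2)] vertical])
        finally have "\<bar>x - (\<gamma> i * y + \<beta> i)\<bar> \<le> \<delta>" by simp
        then have "(x - (\<gamma> i * y + \<beta> i))\<^sup>2 \<le> \<delta>\<^sup>2" using \<delta> by (simp add: abs_le_square_iff[symmetric])
        then have "\<delta> / (2 * \<delta>\<^sup>2) \<le> \<delta> / (\<delta>\<^sup>2 + (x - (\<gamma> i * y + \<beta> i))\<^sup>2)"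
          using \<delta> by (intro divide_left_mono) (auto intro!: mult_pos_pos add_pos_nonneg)
        then show ?thesis using \<delta> by (simp add: poisson_def power2_eq_square)
      qed
      finally show ?thesis .
    qed
    have "?lhs \<le> smoothed_count I \<gamma> \<beta> \<delta> x y" unfolding smoothed_count_def by (intro sum_mono row)
    also have "\<dots> \<le> L + F x y" using low[of x y] by (simp add: F_def)
    also have "\<dots> \<le> W X x * (W Y y * (L + \<mu> / 2)) + (F x y)\<^sup>2 * (11 / \<mu> * poisson 1 y)"
    proof -
      have "0 \<le> (F x y - \<mu>)\<^sup>2" by simp
      then have "2 * \<mu> * F x y \<le> \<mu>\<^sup>2 + (F x y)\<^sup>2" by (simp add: power2_diff algebra_simps)
      then have am_gm: "F x y \<le> \<mu> / 2 + (F x y)\<^sup>2 / (2 * \<mu>)"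
        using \<open>\<mu> > 0\<close> by (simp add: field_simps power2_eq_square)
      have "(F x y)\<^sup>2 / (2 * \<mu>) * 1 \<le> (F x y)\<^sup>2 / (2 * \<mu>) * (22 * poisson 1 y)"
        using chi \<open>\<mu> > 0\<close> by (intro mult_left_mono) auto
      then have "(F x y)\<^sup>2 / (2 * \<mu>) \<le> (F x y)\<^sup>2 * (11 / \<mu> * poisson 1 y)" by (simp add: mult_ac)
      moreover have "1 * (1 * (L + \<mu> / 2)) \<le> W X x * (W Y y * (L + \<mu> / 2))"
        using W1 \<open>L \<ge> 0\<close> \<open>\<mu> > 0\<close> by (intro mult_mono) auto
      ultimately show ?thesis using am_gm by simp
    qed
    finally show ?thesis .
  qed
  have R: "R > 0" using \<delta> by simp
  have inner: "(\<Sum>i\<in>I. \<Sum>a\<in>A. \<delta> * (J (py i a) y / (2 * \<delta>)))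
      \<le> 4 * \<delta> * real (card X) * (W Y y * (L + \<mu> / 2)) + pi * E y * (11 / \<mu> * poisson 1 y)" for y
  proof -
    have "has_bochner_integral lborel (\<lambda>x. \<Sum>i\<in>I. \<Sum>a\<in>A. J (px i a) x * (J (py i a) y / (2 * \<delta>)))
       (\<Sum>i\<in>I. \<Sum>a\<in>A. \<delta> * (J (py i a) y / (2 * \<delta>)))"
      by (intro has_bochner_integral_sum has_bochner_integral_mult_left J_int)
    moreover have "has_bochner_integral lborel
       (\<lambda>x. W X x * (W Y y * (L + \<mu> / 2)) + (F x y)\<^sup>2 * (11 / \<mu> * poisson 1 y))
       (4 * \<delta> * real (card X) * (W Y y * (L + \<mu> / 2)) + pi * E y * (11 / \<mu> * poisson 1 y))"
      unfolding F_def E_def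
      by (intro has_bochner_integral_add has_bochner_integral_mult_left W_int horizontal_energy \<delta>(1) R)
    ultimately show ?thesis using pointwise[of _ y] by (rule has_bochner_integral_le)
  qed
  define T where "T = (\<Sum>i\<in>I. \<Sum>j\<in>I. pair_energy \<delta> R \<bar>\<gamma> i - \<gamma> j\<bar> (\<beta> i - \<beta> j))"
  have "has_bochner_integral lborel (\<lambda>y. \<Sum>i\<in>I. \<Sum>a\<in>A. J (py i a) y * (1 / 2)) (\<Sum>i\<in>I. \<Sum>a\<in>A. \<delta> * (1 / 2))"
    by (intro has_bochner_integral_sum has_bochner_integral_mult_left J_int)
  moreover have "has_bochner_integral lborel
     (\<lambda>y. W Y y * (4 * \<delta> * real (card X) * (L + \<mu> / 2)) + (poisson 1 y * E y) * (11 * pi / \<mu>))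
     (4 * \<delta> * real (card Y) * (4 * \<delta> * real (card X) * (L + \<mu> / 2)) + pi * T * (11 * pi / \<mu>))"
    unfolding E_def T_def
    by (intro has_bochner_integral_add has_bochner_integral_mult_left W_int total_energy \<delta>(1) R)
  moreover have "(\<Sum>i\<in>I. \<Sum>a\<in>A. J (py i a) y * (1 / 2))
      \<le> W Y y * (4 * \<delta> * real (card X) * (L + \<mu> / 2)) + (poisson 1 y * E y) * (11 * pi / \<mu>)" for y
    using inner[of y] \<delta>(1) by (simp add: mult_ac)
  ultimately have "(\<Sum>i\<in>I. \<Sum>a\<in>A. \<delta> * (1 / 2))
      \<le> 4 * \<delta> * real (card Y) * (4 * \<delta> * real (card X) * (L + \<mu> / 2)) + pi * T * (11 * pi / \<mu>)"
    by (rule has_bochner_integral_le)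
  moreover have "T * (11 * pi\<^sup>2 / \<mu>) \<le> S * (11 * pi\<^sup>2 / \<mu>)"
    using high \<open>\<mu> > 0\<close> unfolding T_def by (intro mult_right_mono) auto
  moreover have "pi * T * (11 * pi / \<mu>) = T * (11 * pi\<^sup>2 / \<mu>)"
    by (simp add: power2_eq_square)
  moreover have "4 * \<delta> * real (card Y) * (4 * \<delta> * real (card X) * (L + \<mu> / 2))
      = 16 * \<delta>\<^sup>2 * real (card X) * real (card Y) * (L + \<mu> / 2)"
    by (simp only: power2_eq_square) simp
  moreover have "(\<Sum>i\<in>I. \<Sum>a\<in>A. \<delta> * (1 / 2)) = real (card I) * real (card A) * \<delta> / 2"
    by simp
  moreover have "S * (11 * pi\<^sup>2 / \<mu>) = 11 * pi\<^sup>2 * S / \<mu>" by simp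
  ultimately show ?thesis by linarith
qed

text \<open>
  The line attached to \<open>(p, q) \<in> B \<times> C\<close> is \<open>x = y / q + p\<close>, which contains \<open>(z + p, z q)\<close> for every
  \<open>z \<in> A\<close>. The constants \<open>a\<close> and \<open>b\<close> come from the pointwise bound and from the energy bound. For
  \<open>R = \<bar>A\<bar> \<delta>\<close>, if most incidences come from the low part then \<open>\<delta>\<^sup>2 \<bar>X\<bar> \<bar>Y\<bar>\<close> is at least of order
  \<open>R powr (2 - t)\<close>, and if they come from the high part at least of order \<open>R powr (3 - (t + t'))\<close>.
  As \<open>R \<le> 1\<close> and \<open>t' \<le> 1\<close>, the latter quantity is the smaller one and is a bound in both cases.
\<close>

lemma separated_incidence_bound:
  fixes A B C X Y :: "real set"
  assumes sub: "A \<subseteq> {1..2}" "B \<subseteq> {1..2}" "C \<subseteq> {1..2}" and ne: "B \<noteq> {}" "C \<noteq> {}"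
    and sep: "delta_separated \<delta> A" "delta_separated \<delta> B" "delta_separated \<delta> C"
    and \<delta>: "0 < \<delta>" "\<delta> \<le> R" "R \<le> 1"
    and reg: "delta_set \<delta> t c B" "delta_set \<delta> t' c' C"
    and t: "0 \<le> t" "t \<le> 1" "0 \<le> t'" "t' \<le> 1" "1 < t + t'" and c: "0 < c" "0 < c'"
    and XY: "finite X" "finite Y" "A + B \<subseteq> (\<Union>x\<in>X. cball x \<delta>)" "A * C \<subseteq> (\<Union>y\<in>Y. cball y \<delta>)"
    and a: "a = (1 + 2 powr t / (1 - 2 powr (t - 2))) * (3 * c + 1)"
    and b: "b = 2 * (2 / (1 - 2 powr (1 - (t + t'))) + 2 powr (t + t') / (1 - 2 powr (t + t' - 3)))
              * ((3 * c + 1) * ((3 * c' + 1) * 4 powr t'))"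
    and A: "real (card A) * \<delta> = R"
  shows "R powr (3 - (t + t')) \<le> 64 * (a + 22 * pi\<^sup>2 * b) * \<delta>\<^sup>2 * (real (card X) * real (card Y))"
proof -
  define T where "T = t + t'"
  define N where "N = real (card B) * real (card C)"
  define M where "M = real (card X) * real (card Y)"
  \<comment> \<open>The factor \<open>44 \<pi>\<^sup>2 b\<close> makes the energy term equal to half of the left side of
    \<open>incidence_inequality\<close>, so that it can be absorbed.\<close>
  define \<mu> where "\<mu> = N * (44 * pi\<^sup>2 * b) * R powr (T - 2)"
  define \<gamma> where "\<gamma> = (\<lambda>i::real \<times> real. 1 / snd i)"
  have R: "R > 0" using \<delta> by simp
  have bdd: "bounded A" "bounded B" "bounded C"
    using sub bounded_subset[OF bounded_closed_interval[of 1 2]] by blast+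
  then have fin: "finite A" "finite B" "finite C"
    using delta_separated_finite sep \<delta>(1) by auto
  then have N: "N > 0" using ne by (auto simp: N_def card_gt_0_iff)
  have small: "2 powr (t - 2) < (1::real)" "2 powr (1 - T) < (1::real)" "2 powr (T - 3) < (1::real)"
    using t by (auto intro!: powr_less_one simp: T_def)
  have a0: "a > 0" unfolding a using small c by (intro mult_pos_pos add_pos_nonneg divide_nonneg_pos) auto
  have b0: "b > 0" unfolding b T_def[symmetric] using small c
    by (intro mult_pos_pos add_pos_pos divide_pos_pos) auto
  have countB: "real (card {p\<in>B. max \<delta> \<bar>u - p\<bar> \<le> \<rho>}) \<le> ((3 * c + 1) * real (card B)) * \<rho> powr t"
    if "\<rho> > 0" for u \<rho> using delta_set_count[OF reg(1) sep(2) \<delta>(1) t(1) c(1) that] .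
  have countC: "real (card {p\<in>C. max \<delta> \<bar>u - p\<bar> \<le> \<rho>}) \<le> ((3 * c' + 1) * real (card C)) * \<rho> powr t'"
    if "\<rho> > 0" for u \<rho> using delta_set_count[OF reg(2) sep(3) \<delta>(1) t(3) c(2) that] .
  have low: "smoothed_count (B \<times> C) \<gamma> fst R x y \<le> a * N * R powr (T - 2)" for x y
  proof -
    have "smoothed_count (B \<times> C) \<gamma> fst R x y = (\<Sum>q\<in>C. \<Sum>p\<in>B. poisson R ((x - y / q) - p))"
      unfolding smoothed_count_def \<gamma>_def
      by (subst sum.swap) (simp add: sum.cartesian_product case_prod_unfold algebra_simps)
    also have "\<dots> \<le> of_nat (card C) * ((1 + 2 powr t / (1 - 2 powr (t - 2)))
        * ((3 * c + 1) * real (card B)) * R powr (t - 1))"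
      by (rule sum_bounded_above, rule poisson_sum_bound[OF fin(2) \<delta>(1,2) _ _ countB]) (use c t in auto)
    also have "\<dots> = a * N * R powr (t - 1)" by (simp add: a N_def)
    also have "\<dots> \<le> a * N * R powr (T - 2)"
      using a0 N R \<delta> t by (intro mult_left_mono powr_mono') (auto simp: T_def)
    finally show ?thesis .
  qed
  have high: "(\<Sum>i\<in>B \<times> C. \<Sum>j\<in>B \<times> C. pair_energy \<delta> R \<bar>\<gamma> i - \<gamma> j\<bar> (fst i - fst j)) \<le> N * (b * N * R powr (T - 1))"
  proof -
    have "(\<Sum>j\<in>B \<times> C. pair_energy \<delta> R \<bar>\<gamma> i - \<gamma> j\<bar> (fst i - fst j)) \<le> b * N * R powr (T - 1)"
      if i: "i \<in> B \<times> C" for i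
    proof -
      define e where "e j = max \<delta> (max \<bar>fst i - fst j\<bar> \<bar>\<gamma> i - \<gamma> j\<bar>)" for j
      have "(\<Sum>j\<in>B \<times> C. pair_energy \<delta> R \<bar>\<gamma> i - \<gamma> j\<bar> (fst i - fst j))
        \<le> (\<Sum>j\<in>B \<times> C. 2 * (R - \<delta>)\<^sup>2 / (e j * (max (e j) (R - \<delta>))\<^sup>2))"
        unfolding e_def by (intro sum_mono pair_energy_bound \<delta>)
      also have "\<dots> \<le> 2 * (2 / (1 - 2 powr (1 - T)) + 2 powr T / (1 - 2 powr (T - 3)))
          * ((3 * c + 1) * ((3 * c' + 1) * 4 powr t') * N) * R powr (T - 1)"
      proof (rule kernel_sum_bound)
        fix \<rho> :: real assume \<rho>: "\<rho> > 0"
        have sub': "{j \<in> B \<times> C. e j \<le> \<rho>} \<subseteq>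
          {p\<in>B. max \<delta> \<bar>fst i - p\<bar> \<le> \<rho>} \<times> {q\<in>C. max \<delta> \<bar>snd i - q\<bar> \<le> 4 * \<rho>}"
        proof safe
          fix p q assume pq: "p \<in> B" "q \<in> C" and e: "e (p, q) \<le> \<rho>"
          then show "max \<delta> \<bar>fst i - p\<bar> \<le> \<rho>" by (simp add: e_def)
          have r: "snd i \<in> {1..2}" "q \<in> {1..2}" using i pq sub by (auto simp: mem_Times_iff)
          \<comment> \<open>Inversion distorts distances in \<open>{1..2}\<close> by a factor of at most \<open>4\<close>.\<close>
          have "\<bar>1 / snd i - 1 / q\<bar> \<le> \<rho>" using e by (simp add: e_def \<gamma>_def)
          moreover have "1 / snd i - 1 / q = (q - snd i) / (snd i * q)" using r by (simp add: field_simps)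
          moreover have pos: "0 < snd i * q" using r by auto
          ultimately have "\<bar>q - snd i\<bar> / (snd i * q) \<le> \<rho>" by (simp only: abs_divide abs_of_pos)
          then have "\<bar>q - snd i\<bar> \<le> \<rho> * (snd i * q)" using pos by (simp only: pos_divide_le_eq)
          also have "\<dots> \<le> \<rho> * (2 * 2)" using r \<rho> by (intro mult_left_mono mult_mono) auto
          finally show "max \<delta> \<bar>snd i - q\<bar> \<le> 4 * \<rho>" using e \<rho> by (simp add: e_def)
        qed
        have "card {j \<in> B \<times> C. e j \<le> \<rho>} \<le>
            card {p\<in>B. max \<delta> \<bar>fst i - p\<bar> \<le> \<rho>} * card {q\<in>C. max \<delta> \<bar>snd i - q\<bar> \<le> 4 * \<rho>}"
          unfolding card_cartesian_product[symmetric] by (rule card_mono[OF _ sub']) (use fin in auto)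
        then have "real (card {j \<in> B \<times> C. e j \<le> \<rho>}) \<le>
            real (card {p\<in>B. max \<delta> \<bar>fst i - p\<bar> \<le> \<rho>}) * real (card {q\<in>C. max \<delta> \<bar>snd i - q\<bar> \<le> 4 * \<rho>})"
          unfolding of_nat_mult[symmetric] by (rule of_nat_mono)
        also have "\<dots> \<le> ((3 * c + 1) * real (card B) * \<rho> powr t)
            * ((3 * c' + 1) * real (card C) * (4 * \<rho>) powr t')"
          using countB[of \<rho> "fst i"] countC[of "4 * \<rho>" "snd i"] \<rho> c by (intro mult_mono) auto
        also have "\<dots> = ((3 * c + 1) * ((3 * c' + 1) * 4 powr t') * N) * \<rho> powr T"
          using \<rho> by (simp add: N_def T_def powr_mult powr_add)
        finally show "real (card {j \<in> B \<times> C. e j \<le> \<rho>})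
            \<le> ((3 * c + 1) * ((3 * c' + 1) * 4 powr t') * N) * \<rho> powr T" .
      qed (use fin t c N \<delta> in \<open>auto simp: e_def T_def\<close>)
      also have "\<dots> = b * N * R powr (T - 1)" by (simp add: b T_def)
      finally show ?thesis .
    qed
    then have "(\<Sum>i\<in>B \<times> C. \<Sum>j\<in>B \<times> C. pair_energy \<delta> R \<bar>\<gamma> i - \<gamma> j\<bar> (fst i - fst j))
        \<le> of_nat (card (B \<times> C)) * (b * N * R powr (T - 1))"
      by (rule sum_bounded_above)
    then show ?thesis by (simp add: N_def card_cartesian_product)
  qed
  have \<mu>0: "\<mu> > 0" unfolding \<mu>_def using N b0 R by simp
  have "real (card (B \<times> C)) * real (card A) * \<delta> / 2
    \<le> 16 * \<delta>\<^sup>2 * real (card X) * real (card Y) * (a * N * R powr (T - 2) + \<mu> / 2)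
      + 11 * pi\<^sup>2 * (N * (b * N * R powr (T - 1))) / \<mu>"
  proof (rule incidence_inequality[where px = "\<lambda>i x. x + fst i" and py = "\<lambda>i x. x * snd i"
        and \<gamma> = \<gamma> and \<beta> = fst and R = R])
    fix i x assume i: "i \<in> B \<times> C" and x: "x \<in> A"
    then have s: "snd i \<in> {1..2}" "x \<in> {1..2}" using sub by (auto simp: mem_Times_iff)
    then show "x + fst i = \<gamma> i * (x * snd i) + fst i" by (simp add: \<gamma>_def)
    have "x + fst i \<in> A + B" "x * snd i \<in> A * C"
      using i x by (auto simp: mem_Times_iff intro: set_plus_intro set_times_intro)
    then show "x + fst i \<in> (\<Union>x\<in>X. cball x \<delta>) \<and> x * snd i \<in> (\<Union>y\<in>Y. cball y \<delta>)"
      using XY by blast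
    have "1 * 1 \<le> x * snd i" "x * snd i \<le> 2 * 2" using s by (intro mult_mono; simp)+
    then show "x * snd i \<in> {1..4}" by simp
  next
    fix i x x' assume "x \<in> A" "x' \<in> A" "x \<noteq> x'"
    then show "\<delta> \<le> \<bar>x + fst i - (x' + fst i)\<bar>" using sep(1) by (auto simp: delta_separated_def dist_real_def)
  next
    fix i assume "i \<in> B \<times> C"
    then have "snd i \<in> {1..2}" using sub by (auto simp: mem_Times_iff)
    then show "\<bar>\<gamma> i\<bar> \<le> 1" by (simp add: \<gamma>_def)
  qed (use fin XY \<delta> \<mu>0 a0 N low high in auto)
  also have "real (card (B \<times> C)) * real (card A) * \<delta> / 2 = N * (R / 2)"
    using A by (simp add: N_def card_cartesian_product mult.assoc)
  also have "11 * pi\<^sup>2 * (N * (b * N * R powr (T - 1))) / \<mu> = N * (R / 4)"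
  proof -
    have "R powr (T - 1) = R * R powr (T - 2)"
      using R powr_add[of R 1 "T - 2"] by simp
    then show ?thesis unfolding \<mu>_def using N b0 R by (simp add: field_simps)
  qed
  also have "16 * \<delta>\<^sup>2 * real (card X) * real (card Y) * (a * N * R powr (T - 2) + \<mu> / 2)
      = N * (16 * \<delta>\<^sup>2 * M * (a + 22 * pi\<^sup>2 * b) * R powr (T - 2))"
    unfolding \<mu>_def M_def by (simp add: ring_distribs mult_ac)
  finally have "N * (R / 2) \<le> N * (16 * \<delta>\<^sup>2 * M * (a + 22 * pi\<^sup>2 * b) * R powr (T - 2) + R / 4)"
    by (simp only: distrib_left)
  then have "R / 2 \<le> 16 * \<delta>\<^sup>2 * M * (a + 22 * pi\<^sup>2 * b) * R powr (T - 2) + R / 4"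
    by (simp only: mult_le_cancel_left_pos[OF N])
  then have "R \<le> 4 * (16 * \<delta>\<^sup>2 * M * (a + 22 * pi\<^sup>2 * b) * R powr (T - 2))" by linarith
  also have "\<dots> = 64 * (a + 22 * pi\<^sup>2 * b) * \<delta>\<^sup>2 * M * R powr (T - 2)" by simp
  finally have "R \<le> 64 * (a + 22 * pi\<^sup>2 * b) * \<delta>\<^sup>2 * M * R powr (T - 2)" .
  then have "R * R powr (2 - T) \<le> 64 * (a + 22 * pi\<^sup>2 * b) * \<delta>\<^sup>2 * M * R powr (T - 2) * R powr (2 - T)"
    by (intro mult_right_mono) auto
  also have "\<dots> = 64 * (a + 22 * pi\<^sup>2 * b) * \<delta>\<^sup>2 * M"
    using R by (simp add: mult.assoc flip: powr_add)
  also have "R * R powr (2 - T) = R powr (3 - T)" using R powr_add[of R 1 "2 - T"] by simp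
  finally show ?thesis by (simp add: M_def T_def)
qed

theorem corollary1p13:
  fixes s t t' c c' \<alpha> :: real
  assumes "s \<in> {0..1}" and "t \<in> {0..1}" and "t' \<in> {0..1}"
    and "t + t' > 1"
    and "c > 0" and "c' > 0"
    and "\<alpha> < (t + t' - 1) * (1 - s) / 2"
  shows "\<exists>\<kappa>>0. \<forall>\<delta>\<in>{0<..1}. \<forall>A B C :: real set.
    A \<subseteq> {1..2} \<and> B \<subseteq> {1..2} \<and> C \<subseteq> {1..2} \<and>
    A \<noteq> {} \<and> B \<noteq> {} \<and> C \<noteq> {} \<and>
    delta_separated \<delta> A \<and> delta_separated \<delta> B \<and> delta_separated \<delta> C \<and>
    real (card A) = \<delta> powr (- s) \<and>
    delta_set \<delta> t c B \<and> delta_set \<delta> t' c' C \<longrightarrow>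
    max (real (covering_number \<delta> (A + B))) (real (covering_number \<delta> (A * C)))
      \<ge> \<kappa> * \<delta> powr (- \<alpha>) * real (card A)"
proof -
  define a where "a = (1 + 2 powr t / (1 - 2 powr (t - 2))) * (3 * c + 1)"
  define b where "b = 2 * (2 / (1 - 2 powr (1 - (t + t'))) + 2 powr (t + t') / (1 - 2 powr (t + t' - 3)))
              * ((3 * c + 1) * ((3 * c' + 1) * 4 powr t'))"
  define D where "D = 64 * (a + 22 * pi\<^sup>2 * b)"
  have small: "2 powr (t - 2) < (1::real)" "2 powr (1 - (t + t')) < (1::real)" "2 powr (t + t' - 3) < (1::real)"
    using assms by (auto intro!: powr_less_one)
  have "a > 0" unfolding a_def using small assms by (intro mult_pos_pos add_pos_nonneg divide_nonneg_pos) auto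
  moreover have "b > 0" unfolding b_def using small assms
    by (intro mult_pos_pos add_pos_pos divide_pos_pos) auto
  ultimately have D: "D > 0" unfolding D_def by (intro mult_pos_pos add_pos_pos) auto
  define \<kappa> where "\<kappa> = 1 / sqrt D"
  have \<kappa>: "\<kappa> > 0" "\<kappa>\<^sup>2 = 1 / D" using D by (auto simp: \<kappa>_def power_divide)
  have "\<kappa> * \<delta> powr (- \<alpha>) * real (card A)
      \<le> max (real (covering_number \<delta> (A + B))) (real (covering_number \<delta> (A * C)))"
    if \<delta>: "0 < \<delta>" "\<delta> \<le> 1"
      and sub: "A \<subseteq> {1..2}" "B \<subseteq> {1..2}" "C \<subseteq> {1..2}" and ne: "B \<noteq> {}" "C \<noteq> {}"
      and sep: "delta_separated \<delta> A" "delta_separated \<delta> B" "delta_separated \<delta> C"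
      and card: "real (card A) = \<delta> powr (- s)"
      and reg: "delta_set \<delta> t c B" "delta_set \<delta> t' c' C"
    for \<delta> :: real and A B C :: "real set"
  proof -
    define R where "R = \<delta> powr (1 - s)"
    \<comment> \<open>The larger covering number is at least the square root of the product of the two.\<close>
    define m where "m = max (real (covering_number \<delta> (A + B))) (real (covering_number \<delta> (A * C)))"
    have R: "\<delta> \<le> R" "R \<le> 1"
      using powr_mono'[of "1 - s" 1 \<delta>] \<delta> assms(1) by (auto simp: R_def powr_le1)
    have AR: "real (card A) * \<delta> = R"
      using \<delta> powr_add[of \<delta> "- s" 1] by (simp add: card R_def)
    have "bounded A" "bounded B" "bounded C"
      using sub bounded_subset[OF bounded_closed_interval[of 1 2]] by blast+
    then have fin: "finite A" "finite B" "finite C" using delta_separated_finite sep \<delta>(1) by auto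
    have "finite (A + B)" "A + B \<subseteq> (\<Union>x\<in>A + B. cball x \<delta>)"
         "finite (A * C)" "A * C \<subseteq> (\<Union>x\<in>A * C. cball x \<delta>)"
      using fin \<delta> by (auto intro: finite_set_plus finite_set_times)
    then obtain X Y where XY: "finite X" "A + B \<subseteq> (\<Union>x\<in>X. cball x \<delta>)" "card X = covering_number \<delta> (A + B)"
        "finite Y" "A * C \<subseteq> (\<Union>y\<in>Y. cball y \<delta>)" "card Y = covering_number \<delta> (A * C)"
      using covering_number_attained by metis
    have "R powr (3 - (t + t')) \<le> D * \<delta>\<^sup>2 * (real (card X) * real (card Y))"
      unfolding D_def
      by (rule separated_incidence_bound[OF sub ne sep \<delta>(1) R reg _ _ _ _ _ _ _ XY(1,4,2,5) a_def b_def AR])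
        (use assms in auto)
    also have "\<dots> \<le> D * \<delta>\<^sup>2 * (m * m)"
      using D by (intro mult_left_mono mult_mono) (auto simp: m_def XY)
    finally have M: "R powr (3 - (t + t')) \<le> D * \<delta>\<^sup>2 * m\<^sup>2" by (simp add: power2_eq_square)
    have "(\<kappa> * \<delta> powr (- \<alpha>) * real (card A))\<^sup>2 = (\<delta> powr (- \<alpha> - s))\<^sup>2 / D"
      by (simp add: card power_mult_distrib \<kappa>(2) powr_diff powr_minus field_simps flip: powr_add)
    also have "(\<delta> powr (- \<alpha> - s))\<^sup>2 = \<delta> powr (2 * (- \<alpha> - s))"
      using \<delta> by (simp add: power2_eq_square flip: powr_add)
    also have "\<dots> \<le> \<delta> powr ((1 - s) * (3 - (t + t')) - 2)"
      using \<delta> assms(7) by (intro powr_mono') (auto simp: algebra_simps)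
    also have "\<dots> = R powr (3 - (t + t')) / \<delta>\<^sup>2"
      using \<delta> powr_diff[of \<delta> "(1 - s) * (3 - (t + t'))" 2] unfolding R_def powr_powr by simp
    also have "\<dots> / D \<le> m\<^sup>2"
      using M \<delta> D by (simp add: field_simps)
    finally have "(\<kappa> * \<delta> powr (- \<alpha>) * real (card A))\<^sup>2 \<le> m\<^sup>2" using D by (simp add: divide_right_mono)
    then show ?thesis unfolding m_def[symmetric] by (rule power2_le_imp_le) (simp add: m_def)
  qed
  then show ?thesis using \<kappa>(1) by (intro exI[of _ \<kappa>]) auto
qed

end
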